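(* Let $\mathcal{G}$ be a connected groupoid whose object set $\mathcal{G}_0=\{x=x_1,x_2,\dots,x_n\}$ is finite, and let $\alpha=(A_g,\alpha_g)_{g\in\mathcal{G}}$ be a group-type partial action of $\mathcal{G}$ on the ring $A=\oplus_{y\in\mathcal{G}_0}A_y$, where each $A_y$ is unital, with respect to $x$ and morphisms $h_y:x\to y$ ($y\in\mathcal{G}_0$), $h_x=x$. Let $G=\mathcal{G}(x)$ be the isotropy group at $x$. Let $\beta$ be the global action of the coarse groupoid $\mathcal{G}_0^2$ on $A$, $\varepsilon$ the partial action of $G$ on $A*_{\beta}\mathcal{G}_0^2$, $R=(A_{x_i}\delta_{(j,i)})_{i,j\in\mathbb{I}_n}$ the generalized matrix ring, and $\gamma$ the partial action of $G$ on $R$, all as defined explicitly in the context. Then there are ring isomorphisms $$A*_{\alpha}\mathcal{G}\;\simeq\;(A*_{\beta}\mathcal{G}_0^2)*_{\varepsilon}G\;\simeq\;R*_{\gamma}G.$$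
   Context: $\mathbb{I}_n=\{1,\dots,n\}$. A groupoid $\mathcal{G}$ is a small category in which every morphism is invertible; $s(g),t(g)$ are source and target, objects are identified with identity morphisms, $gh$ exists iff $s(g)=t(h)$, $\mathcal{G}(y,z)$ is the set of morphisms $y\to z$, $\mathcal{G}(x)=\mathcal{G}(x,x)$. $\mathcal{G}$ is connected if $\mathcal{G}(y,z)\ne\emptyset$ for all objects $y,z$. The coarse groupoid $\mathcal{G}_0^2=\mathcal{G}_0\times\mathcal{G}_0$ has $s(y,z)=y$, $t(y,z)=z$, and $(y,z)(w,y)=(w,z)$. A partial action of $\mathcal{G}$ on a ring $A$ is a family $\alpha=(A_g,\alpha_g)_{g\in\mathcal{G}}$ where $A_{t(g)}$ is an ideal of $A$, $A_g$ is an ideal of $A_{t(g)}$, and $\alpha_g:A_{g^{-1}}\to A_g$ is a ring isomorphism, such that $\alpha_y=\mathrm{id}_{A_y}$ for $y\in\mathcal{G}_0$ and, whenever $s(g)=t(h)$, $\alpha_h^{-1}(A_h\cap A_{g^{-1}})\subset A_{(gh)^{-1}}$ and $\alpha_g(\alpha_h(a))=\alpha_{gh}(a)$ for all $a\in\alpha_h^{-1}(A_h\cap A_{g^{-1}})$. It is global if $A_g=A_{t(g)}$ for all $g$. It is group-type if there are $x\in\mathcal{G}_0$ and morphisms $h_y\in\mathcal{G}(x,y)$, $y\in\mathcal{G}_0$, with $h_x=x$, $A_{h_y^{-1}}=A_x$ and $A_{h_y}=A_y$ for all $y$ (so $\alpha_{h_y}:A_x\to A_y$ is an isomorphism). A partial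 action of a group on a ring $A$ is the one-object case, with $A_e=A$. The partial skew groupoid ring $A*_{\alpha}\mathcal{G}$ is the set of finite formal sums $\sum_g a_g\delta_g$, $a_g\in A_g$, with the usual addition and the multiplication determined by $(a_g\delta_g)(a_h\delta_h)=\alpha_g(\alpha_{g^{-1}}(a_g)a_h)\delta_{gh}$ if $s(g)=t(h)$ and $0$ otherwise. The partial skew group ring of a partial group action is the one-object case. $\beta=(A_{(x_i,x_j)},\beta_{(x_i,x_j)})$ is the global action of $\mathcal{G}_0^2$ on $A$ with $A_{(x_i,x_j)}=A_{x_j}$, $\beta_{(x_i,x_j)}=\alpha_{h_{x_j}}\alpha_{h_{x_i}^{-1}}:A_{x_i}\to A_{x_j}$. $\varepsilon=(C_g,\varepsilon_g)_{g\in G}$ is the partial action of $G=\mathcal{G}(x)$ on $A*_{\beta}\mathcal{G}_0^2$ with $C_g=\oplus_{u\in\mathcal{G}_0^2}\alpha_{h_{t(u)}}(A_g)\delta_u$ and $\varepsilon_g(\alpha_{h_{t(u)}}(a)\delta_u)=\alpha_{h_{t(u)}}(\alpha_g(a))\delta_u$ for $a\in A_{g^{-1}}$, $u\in\mathcal{G}_0^2$. Put $A_i=A_{x_i}$, $\theta_i=\alpha_{h_{x_i}}:A_1\to A_i$, $\theta_{ij}=\theta_j\theta_i^{-1}:A_i\to A_j$. $R=(M_{ij})_{i,j\in\mathbb{I}_n}$ with $M_{ij}=A_i\delta_{(j,i)}$ is the generalized matrix ring: elements are $n\times n$ arrays with $(i,j)$ entry in $M_{ij}$, addition is componentwise, multiplication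 is row-column, with entries multiplied by $(r\delta_{(j,i)})(s\delta_{(k,j)})=r\,\theta_{ij}^{-1}(s)\delta_{(k,i)}$ for $r\in A_i$, $s\in A_j$. $\gamma=(I_g,\gamma_g)_{g\in G}$ is the partial action of $G$ on $R$ with $I_g=\big(\alpha_{h_{x_i}}(A_g)\delta_{(j,i)}\big)_{i,j}$ and $\gamma_g$ acting entrywise by $\gamma^{(ij)}_g\big(\alpha_{h_{x_i}}(a)\delta_{(j,i)}\big)=\alpha_{h_{x_i}}(\alpha_g(a))\delta_{(j,i)}$, $a\in A_{g^{-1}}$. *)

theory Defs
  imports "HOL-Algebra.Algebra"
begin

section \<open>Groupoids\<close>

text \<open>Objects are identified with their identity morphisms, so source and target are
  morphisms; composition is only meaningful for \<open>Src g = Tgt h\<close>.\<close>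

record 'g groupoid =
  Mor :: "'g set"
  Src :: "'g \<Rightarrow> 'g"
  Tgt :: "'g \<Rightarrow> 'g"
  Cmp :: "'g \<Rightarrow> 'g \<Rightarrow> 'g"

locale groupoid =
  fixes Gr :: "'g groupoid"
  assumes Src_Mor: "g \<in> Mor Gr \<Longrightarrow> Src Gr g \<in> Mor Gr"
    and Tgt_Mor: "g \<in> Mor Gr \<Longrightarrow> Tgt Gr g \<in> Mor Gr"
    and Src_Src: "g \<in> Mor Gr \<Longrightarrow> Src Gr (Src Gr g) = Src Gr g"
    and Tgt_Src: "g \<in> Mor Gr \<Longrightarrow> Tgt Gr (Src Gr g) = Src Gr g"
    and Src_Tgt: "g \<in> Mor Gr \<Longrightarrow> Src Gr (Tgt Gr g) = Tgt Gr g"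
    and Tgt_Tgt: "g \<in> Mor Gr \<Longrightarrow> Tgt Gr (Tgt Gr g) = Tgt Gr g"
    and Cmp_Mor: "\<lbrakk>g \<in> Mor Gr; h \<in> Mor Gr; Src Gr g = Tgt Gr h\<rbrakk> \<Longrightarrow> Cmp Gr g h \<in> Mor Gr"
    and Src_Cmp: "\<lbrakk>g \<in> Mor Gr; h \<in> Mor Gr; Src Gr g = Tgt Gr h\<rbrakk> \<Longrightarrow> Src Gr (Cmp Gr g h) = Src Gr h"
    and Tgt_Cmp: "\<lbrakk>g \<in> Mor Gr; h \<in> Mor Gr; Src Gr g = Tgt Gr h\<rbrakk> \<Longrightarrow> Tgt Gr (Cmp Gr g h) = Tgt Gr g"
    and Cmp_assoc: "\<lbrakk>g \<in> Mor Gr; h \<in> Mor Gr; k \<in> Mor Gr; Src Gr g = Tgt Gr h; Src Gr h = Tgt Gr k\<rbrakk>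
        \<Longrightarrow> Cmp Gr (Cmp Gr g h) k = Cmp Gr g (Cmp Gr h k)"
    and Cmp_Src: "g \<in> Mor Gr \<Longrightarrow> Cmp Gr g (Src Gr g) = g"
    and Cmp_Tgt: "g \<in> Mor Gr \<Longrightarrow> Cmp Gr (Tgt Gr g) g = g"
    and ex_inverse: "g \<in> Mor Gr \<Longrightarrow> \<exists>h\<in>Mor Gr. Src Gr h = Tgt Gr g \<and> Tgt Gr h = Src Gr g
        \<and> Cmp Gr g h = Tgt Gr g \<and> Cmp Gr h g = Src Gr g"

definition Obj :: "'g groupoid \<Rightarrow> 'g set" where
  "Obj Gr = {e \<in> Mor Gr. Src Gr e = e}"

definition hom_set :: "'g groupoid \<Rightarrow> 'g \<Rightarrow> 'g \<Rightarrow> 'g set" where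
  "hom_set Gr y z = {g \<in> Mor Gr. Src Gr g = y \<and> Tgt Gr g = z}"

definition ginv :: "'g groupoid \<Rightarrow> 'g \<Rightarrow> 'g" where
  "ginv Gr g = (THE h. h \<in> Mor Gr \<and> Src Gr h = Tgt Gr g \<and> Tgt Gr h = Src Gr g
      \<and> Cmp Gr g h = Tgt Gr g \<and> Cmp Gr h g = Src Gr g)"

definition connected_groupoid :: "'g groupoid \<Rightarrow> bool" where
  "connected_groupoid Gr \<longleftrightarrow> (\<forall>y\<in>Obj Gr. \<forall>z\<in>Obj Gr. hom_set Gr y z \<noteq> {})"

text \<open>Groups are treated as one-object groupoids.\<close>

definition isotropy :: "'g groupoid \<Rightarrow> 'g \<Rightarrow> 'g groupoid" where
  "isotropy Gr x = Gr\<lparr>Mor := hom_set Gr x x\<rparr>"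

text \<open>In the coarse groupoid the object \<open>y\<close> is the identity morphism \<open>(y, y)\<close>.\<close>

definition coarse :: "'o set \<Rightarrow> ('o \<times> 'o) groupoid" where
  "coarse Y = \<lparr>Mor = Y \<times> Y, Src = (\<lambda>(y, z). (y, y)), Tgt = (\<lambda>(y, z). (z, z)),
     Cmp = (\<lambda>(y, z) (w, y'). (w, z))\<rparr>"

lemma groupoid_isotropy:
  assumes "groupoid Gr" and "x \<in> Obj Gr"
  shows "groupoid (isotropy Gr x)"
proof -
  interpret groupoid Gr by fact
  have x: "x \<in> Mor Gr" "Src Gr x = x" using assms(2) by (auto simp: Obj_def)
  have x': "Tgt Gr x = x" using Tgt_Src[OF x(1)] x(2) by simp
  show ?thesis
  proof
    fix g assume "g \<in> Mor (isotropy Gr x)"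
    then have "g \<in> Mor Gr" "Src Gr g = x" "Tgt Gr g = x" by (auto simp: isotropy_def hom_set_def)
    then show "\<exists>h\<in>Mor (isotropy Gr x). Src (isotropy Gr x) h = Tgt (isotropy Gr x) g
        \<and> Tgt (isotropy Gr x) h = Src (isotropy Gr x) g
        \<and> Cmp (isotropy Gr x) g h = Tgt (isotropy Gr x) g
        \<and> Cmp (isotropy Gr x) h g = Src (isotropy Gr x) g"
      using ex_inverse[of g] by (auto simp: isotropy_def hom_set_def)
  qed (use x x' in \<open>auto simp: isotropy_def hom_set_def Cmp_Mor Src_Cmp Tgt_Cmp Cmp_assoc
         intro: Cmp_Src Cmp_Tgt dest: Cmp_Src Cmp_Tgt\<close>)
qed

lemma groupoid_coarse: "groupoid (coarse Y)"
  by unfold_locales (auto simp: coarse_def)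

section \<open>Partial actions of groupoids on rings\<close>

text \<open>Ideals of \<open>A\<close> are regarded as rings in their own right, possibly without identity;
  \<open>ideal_of A J I\<close> says that \<open>I\<close> is a two-sided ideal of such a ring \<open>J \<subseteq> A\<close>.\<close>

definition ideal_of :: "('a, 'm) ring_scheme \<Rightarrow> 'a set \<Rightarrow> 'a set \<Rightarrow> bool" where
  "ideal_of A J I \<longleftrightarrow> I \<subseteq> J \<and> additive_subgroup I A
     \<and> (\<forall>a\<in>I. \<forall>b\<in>J. a \<otimes>\<^bsub>A\<^esub> b \<in> I \<and> b \<otimes>\<^bsub>A\<^esub> a \<in> I)"

definition iso_between :: "('a, 'm) ring_scheme \<Rightarrow> 'a set \<Rightarrow> 'a set \<Rightarrow> ('a \<Rightarrow> 'a) \<Rightarrow> bool" where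
  "iso_between A I J f \<longleftrightarrow> bij_betw f I J
     \<and> (\<forall>a\<in>I. \<forall>b\<in>I. f (a \<oplus>\<^bsub>A\<^esub> b) = f a \<oplus>\<^bsub>A\<^esub> f b \<and> f (a \<otimes>\<^bsub>A\<^esub> b) = f a \<otimes>\<^bsub>A\<^esub> f b)"

definition is_identity_of :: "('a, 'm) ring_scheme \<Rightarrow> 'a set \<Rightarrow> 'a \<Rightarrow> bool" where
  "is_identity_of A I e \<longleftrightarrow> e \<in> I \<and> (\<forall>a\<in>I. e \<otimes>\<^bsub>A\<^esub> a = a \<and> a \<otimes>\<^bsub>A\<^esub> e = a)"

definition unital :: "('a, 'm) ring_scheme \<Rightarrow> 'a set \<Rightarrow> bool" where
  "unital A I \<longleftrightarrow> (\<exists>e. is_identity_of A I e)"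

definition identity_of :: "('a, 'm) ring_scheme \<Rightarrow> 'a set \<Rightarrow> 'a" where
  "identity_of A I = (THE e. is_identity_of A I e)"

locale partial_action = groupoid Gr + ring A
  for A :: "('a, 'm) ring_scheme" and Gr :: "'g groupoid"
    and D :: "'g \<Rightarrow> 'a set" and \<alpha> :: "'g \<Rightarrow> 'a \<Rightarrow> 'a" +
  assumes ideal_Tgt: "g \<in> Mor Gr \<Longrightarrow> ideal (D (Tgt Gr g)) A"
    and ideal_D: "g \<in> Mor Gr \<Longrightarrow> ideal_of A (D (Tgt Gr g)) (D g)"
    and iso_D: "g \<in> Mor Gr \<Longrightarrow> iso_between A (D (ginv Gr g)) (D g) (\<alpha> g)"
    and action_Obj: "\<lbrakk>y \<in> Obj Gr; a \<in> D y\<rbrakk> \<Longrightarrow> \<alpha> y a = a"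
    and preimage_D: "\<lbrakk>g \<in> Mor Gr; h \<in> Mor Gr; Src Gr g = Tgt Gr h\<rbrakk>
        \<Longrightarrow> {a \<in> D (ginv Gr h). \<alpha> h a \<in> D h \<inter> D (ginv Gr g)} \<subseteq> D (ginv Gr (Cmp Gr g h))"
    and action_Cmp: "\<lbrakk>g \<in> Mor Gr; h \<in> Mor Gr; Src Gr g = Tgt Gr h;
          a \<in> D (ginv Gr h); \<alpha> h a \<in> D h \<inter> D (ginv Gr g)\<rbrakk>
        \<Longrightarrow> \<alpha> g (\<alpha> h a) = \<alpha> (Cmp Gr g h) a"

text \<open>Group-type with respect to a given object \<open>x\<close> and given morphisms \<open>h y : x \<rightarrow> y\<close>.\<close>

definition group_type :: "'g groupoid \<Rightarrow> ('g \<Rightarrow> 'a set) \<Rightarrow> 'g \<Rightarrow> ('g \<Rightarrow> 'g) \<Rightarrow> bool" where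
  "group_type Gr D x h \<longleftrightarrow> x \<in> Obj Gr \<and> h x = x
     \<and> (\<forall>y\<in>Obj Gr. h y \<in> hom_set Gr x y \<and> D (ginv Gr (h y)) = D x \<and> D (h y) = D y)"

text \<open>Internal direct sum, for a finite index set \<open>Y\<close>.\<close>

definition is_direct_sum :: "('a, 'm) ring_scheme \<Rightarrow> 'g set \<Rightarrow> ('g \<Rightarrow> 'a set) \<Rightarrow> bool" where
  "is_direct_sum A Y D \<longleftrightarrow> (\<forall>y\<in>Y. D y \<subseteq> carrier A)
     \<and> (\<forall>a\<in>carrier A. \<exists>!f. f \<in> (\<Pi>\<^sub>E y\<in>Y. D y) \<and> a = (\<Oplus>\<^bsub>A\<^esub>y\<in>Y. f y))"

section \<open>Partial skew groupoid rings\<close>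

text \<open>The formal sum \<open>\<Sum>\<^sub>g a\<^sub>g \<delta>\<^sub>g\<close> is the finitely supported function \<open>g \<mapsto> a\<^sub>g\<close>, which vanishes
  outside \<open>Mor Gr\<close>. The product is the biadditive extension of the product of monomials; since the
  ideals \<open>D g\<close> need not be unital, it need not be associative. The field \<open>one\<close> is the formal sum
  \<open>\<Sum>\<^sub>y 1\<^sub>y \<delta>\<^sub>y\<close> over the objects, which is an identity element if there are finitely many objects
  and all \<open>D y\<close> are unital.\<close>

definition skew_ring ::
  "('a, 'm) ring_scheme \<Rightarrow> 'g groupoid \<Rightarrow> ('g \<Rightarrow> 'a set) \<Rightarrow> ('g \<Rightarrow> 'a \<Rightarrow> 'a) \<Rightarrow> ('g \<Rightarrow> 'a) ring" where
  "skew_ring A Gr D \<alpha> = \<lparr>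
     carrier = {f. (\<forall>g\<in>Mor Gr. f g \<in> D g) \<and> (\<forall>g. g \<notin> Mor Gr \<longrightarrow> f g = \<zero>\<^bsub>A\<^esub>)
                   \<and> finite {g. f g \<noteq> \<zero>\<^bsub>A\<^esub>}},
     monoid.mult = (\<lambda>f f' k. finsum A
        (\<lambda>(g, h). \<alpha> g (\<alpha> (ginv Gr g) (f g) \<otimes>\<^bsub>A\<^esub> f' h))
        {(g, h). g \<in> Mor Gr \<and> h \<in> Mor Gr \<and> Src Gr g = Tgt Gr h \<and> Cmp Gr g h = k
           \<and> f g \<noteq> \<zero>\<^bsub>A\<^esub> \<and> f' h \<noteq> \<zero>\<^bsub>A\<^esub>}),
     monoid.one = (\<lambda>g. if g \<in> Obj Gr then identity_of A (D g) else \<zero>\<^bsub>A\<^esub>),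
     ring.zero = (\<lambda>g. \<zero>\<^bsub>A\<^esub>),
     ring.add = (\<lambda>f f' g. f g \<oplus>\<^bsub>A\<^esub> f' g)\<rparr>"

section \<open>The action of the coarse groupoid and the induced action of the isotropy group\<close>

definition beta_dom :: "('g \<Rightarrow> 'a set) \<Rightarrow> 'g \<times> 'g \<Rightarrow> 'a set" where
  "beta_dom D u = D (snd u)"

definition beta_map ::
  "'g groupoid \<Rightarrow> ('g \<Rightarrow> 'a \<Rightarrow> 'a) \<Rightarrow> ('g \<Rightarrow> 'g) \<Rightarrow> 'g \<times> 'g \<Rightarrow> 'a \<Rightarrow> 'a" where
  "beta_map Gr \<alpha> h u a = \<alpha> (h (snd u)) (\<alpha> (ginv Gr (h (fst u))) a)"

definition coarse_skew_ring ::
  "('a, 'm) ring_scheme \<Rightarrow> 'g groupoid \<Rightarrow> ('g \<Rightarrow> 'a set) \<Rightarrow> ('g \<Rightarrow> 'a \<Rightarrow> 'a) \<Rightarrow> ('g \<Rightarrow> 'g)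
    \<Rightarrow> ('g \<times> 'g \<Rightarrow> 'a) ring" where
  "coarse_skew_ring A Gr D \<alpha> h =
     skew_ring A (coarse (Obj Gr)) (beta_dom D) (beta_map Gr \<alpha> h)"

definition eps_dom ::
  "('a, 'm) ring_scheme \<Rightarrow> 'g groupoid \<Rightarrow> ('g \<Rightarrow> 'a set) \<Rightarrow> ('g \<Rightarrow> 'a \<Rightarrow> 'a) \<Rightarrow> ('g \<Rightarrow> 'g)
    \<Rightarrow> 'g \<Rightarrow> ('g \<times> 'g \<Rightarrow> 'a) set" where
  "eps_dom A Gr D \<alpha> h g =
     {f \<in> carrier (coarse_skew_ring A Gr D \<alpha> h).
        \<forall>u \<in> Obj Gr \<times> Obj Gr. f u \<in> \<alpha> (h (snd u)) ` D g}"

definition eps_map ::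
  "('a, 'm) ring_scheme \<Rightarrow> 'g groupoid \<Rightarrow> ('g \<Rightarrow> 'a set) \<Rightarrow> ('g \<Rightarrow> 'a \<Rightarrow> 'a) \<Rightarrow> ('g \<Rightarrow> 'g)
    \<Rightarrow> 'g \<Rightarrow> ('g \<times> 'g \<Rightarrow> 'a) \<Rightarrow> 'g \<times> 'g \<Rightarrow> 'a" where
  "eps_map A Gr D \<alpha> h g f u =
     (if u \<in> Obj Gr \<times> Obj Gr
      then \<alpha> (h (snd u)) (\<alpha> g (inv_into (D (ginv Gr g)) (\<alpha> (h (snd u))) (f u)))
      else \<zero>\<^bsub>A\<^esub>)"

section \<open>The generalized matrix ring and the induced action on it\<close>

text \<open>\<open>xs\<close> enumerates the objects as \<open>xs 1, \<dots>, xs n\<close>. The entry \<open>r \<delta>(j, i)\<close> in position \<open>(i, j)\<close>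
  of an array is represented by \<open>r\<close>; arrays vanish outside \<open>{1..n} \<times> {1..n}\<close>. Here
  \<open>theta2 \<dots> i j\<close> is the map \<open>A\<^sub>i \<rightarrow> A\<^sub>j\<close>, inverted in the product.\<close>

definition theta :: "('g \<Rightarrow> 'a \<Rightarrow> 'a) \<Rightarrow> ('g \<Rightarrow> 'g) \<Rightarrow> (nat \<Rightarrow> 'g) \<Rightarrow> nat \<Rightarrow> 'a \<Rightarrow> 'a" where
  "theta \<alpha> h xs i = \<alpha> (h (xs i))"

definition theta2 ::
  "('g \<Rightarrow> 'a set) \<Rightarrow> ('g \<Rightarrow> 'a \<Rightarrow> 'a) \<Rightarrow> ('g \<Rightarrow> 'g) \<Rightarrow> (nat \<Rightarrow> 'g) \<Rightarrow> nat \<Rightarrow> nat \<Rightarrow> 'a \<Rightarrow> 'a" where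
  "theta2 D \<alpha> h xs i j a = theta \<alpha> h xs j (inv_into (D (xs 1)) (theta \<alpha> h xs i) a)"

definition matrix_ring ::
  "('a, 'm) ring_scheme \<Rightarrow> ('g \<Rightarrow> 'a set) \<Rightarrow> ('g \<Rightarrow> 'a \<Rightarrow> 'a) \<Rightarrow> ('g \<Rightarrow> 'g) \<Rightarrow> nat \<Rightarrow> (nat \<Rightarrow> 'g)
    \<Rightarrow> (nat \<Rightarrow> nat \<Rightarrow> 'a) ring" where
  "matrix_ring A D \<alpha> h n xs = \<lparr>
     carrier = {m. (\<forall>i\<in>{1..n}. \<forall>j\<in>{1..n}. m i j \<in> D (xs i))
                   \<and> (\<forall>i j. \<not> (i \<in> {1..n} \<and> j \<in> {1..n}) \<longrightarrow> m i j = \<zero>\<^bsub>A\<^esub>)},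
     monoid.mult = (\<lambda>m m' i k. if i \<in> {1..n} \<and> k \<in> {1..n}
        then (\<Oplus>\<^bsub>A\<^esub>j\<in>{1..n}. m i j \<otimes>\<^bsub>A\<^esub> inv_into (D (xs i)) (theta2 D \<alpha> h xs i j) (m' j k))
        else \<zero>\<^bsub>A\<^esub>),
     monoid.one = (\<lambda>i j. if i \<in> {1..n} \<and> i = j then identity_of A (D (xs i)) else \<zero>\<^bsub>A\<^esub>),
     ring.zero = (\<lambda>i j. \<zero>\<^bsub>A\<^esub>),
     ring.add = (\<lambda>m m' i j. m i j \<oplus>\<^bsub>A\<^esub> m' i j)\<rparr>"

definition gamma_dom ::
  "('a, 'm) ring_scheme \<Rightarrow> ('g \<Rightarrow> 'a set) \<Rightarrow> ('g \<Rightarrow> 'a \<Rightarrow> 'a) \<Rightarrow> ('g \<Rightarrow> 'g) \<Rightarrow> nat \<Rightarrow> (nat \<Rightarrow> 'g)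
    \<Rightarrow> 'g \<Rightarrow> (nat \<Rightarrow> nat \<Rightarrow> 'a) set" where
  "gamma_dom A D \<alpha> h n xs g =
     {m \<in> carrier (matrix_ring A D \<alpha> h n xs).
        \<forall>i\<in>{1..n}. \<forall>j\<in>{1..n}. m i j \<in> \<alpha> (h (xs i)) ` D g}"

definition gamma_map ::
  "('a, 'm) ring_scheme \<Rightarrow> 'g groupoid \<Rightarrow> ('g \<Rightarrow> 'a set) \<Rightarrow> ('g \<Rightarrow> 'a \<Rightarrow> 'a) \<Rightarrow> ('g \<Rightarrow> 'g)
    \<Rightarrow> nat \<Rightarrow> (nat \<Rightarrow> 'g) \<Rightarrow> 'g \<Rightarrow> (nat \<Rightarrow> nat \<Rightarrow> 'a) \<Rightarrow> nat \<Rightarrow> nat \<Rightarrow> 'a" where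
  "gamma_map A Gr D \<alpha> h n xs g m i j =
     (if i \<in> {1..n} \<and> j \<in> {1..n}
      then \<alpha> (h (xs i)) (\<alpha> g (inv_into (D (ginv Gr g)) (\<alpha> (h (xs i))) (m i j)))
      else \<zero>\<^bsub>A\<^esub>)"

end

theory Submission
  imports Defs
begin

text \<open>
  Write \<open>h\<^sub>y : x \<rightarrow> y\<close> for the chosen morphisms, \<open>\<theta>\<^sub>y = \<alpha>\<^bsub>h\<^sub>y\<^esub> : A\<^sub>x \<rightarrow> A\<^sub>y\<close> for the ring isomorphisms that
  they induce, and \<open>G\<close> for the isotropy group at \<open>x\<close>. Every morphism \<open>g : y \<rightarrow> z\<close> factors uniquely
  as \<open>g = h\<^sub>z k h\<^sub>y\<^sup>-\<^sup>1\<close> with a loop \<open>k \<in> G\<close>, so the groupoid is, as a set, the product of the coarse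
  groupoid and \<open>G\<close>, and composition splits accordingly: the pairs \<open>(y, z)\<close> compose in the coarse
  groupoid and the loops multiply in \<open>G\<close> (lemma \<open>Cmp_arrow\<close>).

  The partial action splits in the same way. Since \<open>\<alpha>\<close> is of group type, the morphisms \<open>h\<^sub>y\<close> act
  globally, from all of \<open>A\<^sub>x\<close> onto all of \<open>A\<^sub>y\<close>, and composing with such a morphism loses nothing of
  the domains. Hence \<open>A\<^sub>g = \<theta>\<^sub>z(A\<^sub>k)\<close>, and \<open>\<alpha>\<^sub>g\<close> is \<open>\<alpha>\<^sub>k\<close> transported by \<open>\<theta>\<^sub>y\<close> and \<open>\<theta>\<^sub>z\<close> (lemmas \<open>D_arrow\<close>
  and \<open>action_arrow\<close>). So the map \<open>a \<delta>\<^sub>g \<mapsto> (a \<delta>\<^bsub>(y, z)\<^esub>) \<delta>\<^sub>k\<close> is a bijection from \<open>A * Gr\<close> onto the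
  iterated skew ring. It is multiplicative because, in terms of the coordinates \<open>\<theta>\<^sub>z\<^sup>-\<^sup>1(a)\<close> in \<open>A\<^sub>x\<close>,
  the product of two monomials is \<open>\<alpha>\<^sub>k(\<alpha>\<^sub>k\<^sup>-\<^sup>1(a) b)\<close> on both sides (\<open>monomial_mult_arrow\<close> and
  \<open>eps_monomial_mult\<close>). For sums of monomials, what remains is to match the factorizations of
  \<open>h\<^sub>z m h\<^sub>w\<^sup>-\<^sup>1\<close> in the groupoid with the pairs formed by a factorization of \<open>m\<close> in \<open>G\<close> and an
  intermediate object \<open>y\<close> (\<open>regroup_mult\<close>).

  The second isomorphism is formal. The coarse skew ring and the generalized matrix ring are the
  same ring: the coefficient of \<open>\<delta>\<^bsub>(x\<^sub>j, x\<^sub>i)\<^esub>\<close> is the entry in position \<open>(i, j)\<close>. This identification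
  carries \<open>\<epsilon>\<close> to \<open>\<gamma>\<close>, and skew rings are functorial in the coefficients
  (\<open>skew_ring_iso_transport\<close>).
\<close>

section \<open>Finite sums\<close>

text \<open>The maps \<open>\<alpha>\<^sub>g\<close> are additive on their domains only, so a sum may be moved through them only if
  all its terms, and hence its partial sums, stay in the domain. The conclusion also records that
  the sum lies there.\<close>

lemma finsum_additive_on:
  fixes R :: "('b, 'r) ring_scheme" and S :: "('c, 's) ring_scheme"
  assumes R: "abelian_monoid R" and S: "abelian_monoid S"
    and H: "H \<subseteq> carrier R" "\<zero>\<^bsub>R\<^esub> \<in> H" "\<And>a b. \<lbrakk>a \<in> H; b \<in> H\<rbrakk> \<Longrightarrow> a \<oplus>\<^bsub>R\<^esub> b \<in> H"
    and \<phi>: "\<And>a. a \<in> H \<Longrightarrow> \<phi> a \<in> carrier S" "\<phi> \<zero>\<^bsub>R\<^esub> = \<zero>\<^bsub>S\<^esub>"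
      "\<And>a b. \<lbrakk>a \<in> H; b \<in> H\<rbrakk> \<Longrightarrow> \<phi> (a \<oplus>\<^bsub>R\<^esub> b) = \<phi> a \<oplus>\<^bsub>S\<^esub> \<phi> b"
    and I: "finite I" "\<And>i. i \<in> I \<Longrightarrow> f i \<in> H"
  shows "finsum R f I \<in> H \<and> \<phi> (finsum R f I) = finsum S (\<lambda>i. \<phi> (f i)) I"
  using I
proof (induction I)
  case empty
  then show ?case
    using H(2) \<phi>(2) by (simp add: abelian_monoid.finsum_empty[OF R] abelian_monoid.finsum_empty[OF S])
next
  case (insert i I)
  have "f \<in> I \<rightarrow> carrier R" "f i \<in> carrier R" using insert.prems H(1) by auto
  then have 1: "finsum R f (insert i I) = f i \<oplus>\<^bsub>R\<^esub> finsum R f I"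
    by (rule abelian_monoid.finsum_insert[OF R insert.hyps])
  have "(\<lambda>i. \<phi> (f i)) \<in> I \<rightarrow> carrier S" "\<phi> (f i) \<in> carrier S" using insert.prems \<phi>(1) by auto
  then have 2: "finsum S (\<lambda>i. \<phi> (f i)) (insert i I)
      = \<phi> (f i) \<oplus>\<^bsub>S\<^esub> finsum S (\<lambda>i. \<phi> (f i)) I"
    by (rule abelian_monoid.finsum_insert[OF S insert.hyps])
  have IH: "finsum R f I \<in> H" "\<phi> (finsum R f I) = finsum S (\<lambda>i. \<phi> (f i)) I"
    using insert.IH insert.prems by simp_all
  have fi: "f i \<in> H" using insert.prems by simp
  show ?case unfolding 1 2 using H(3)[OF fi IH(1)] \<phi>(3)[OF fi IH(1)] IH(2) by simp
qed

lemma (in abelian_monoid) finsum_Times: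
  assumes "finite I" "finite J" "\<And>i j. \<lbrakk>i \<in> I; j \<in> J\<rbrakk> \<Longrightarrow> f i j \<in> carrier G"
  shows "finsum G (\<lambda>i. finsum G (f i) J) I = finsum G (\<lambda>(i, j). f i j) (I \<times> J)"
  using assms(1,3)
proof (induction I)
  case empty
  then show ?case by simp
next
  case (insert i I)
  have fib: "finsum G (f i) J = finsum G (\<lambda>(i, j). f i j) ({i} \<times> J)"
  proof -
    have "{i} \<times> J = (\<lambda>j. (i, j)) ` J" by auto
    moreover have "finsum G (\<lambda>(i, j). f i j) ((\<lambda>j. (i, j)) ` J) = finsum G (f i) J"
      using insert.prems by (subst finsum_reindex) (auto simp: inj_on_def)
    ultimately show ?thesis by simp
  qed
  have un: "insert i I \<times> J = ({i} \<times> J) \<union> (I \<times> J)" by auto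
  have "finsum G (\<lambda>(i, j). f i j) (insert i I \<times> J)
      = finsum G (\<lambda>(i, j). f i j) ({i} \<times> J) \<oplus> finsum G (\<lambda>(i, j). f i j) (I \<times> J)"
    unfolding un by (rule finsum_Un_disjoint) (use insert assms(2) in auto)
  moreover have "finsum G (\<lambda>i. finsum G (f i) J) (insert i I)
      = finsum G (f i) J \<oplus> finsum G (\<lambda>i. finsum G (f i) J) I"
    using insert by (intro finsum_insert) (auto intro!: finsum_closed)
  ultimately show ?case using insert fib by auto
qed

lemma (in abelian_monoid) finsum_single:
  assumes "finite I" "i \<in> I" "f i \<in> carrier G" "\<And>j. \<lbrakk>j \<in> I; j \<noteq> i\<rbrakk> \<Longrightarrow> f j = \<zero>"
  shows "finsum G f I = f i"
proof -
  have "finsum G f {i} = finsum G f I"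
  proof (rule add.finprod_mono_neutral_cong_left)
    show "f \<in> I \<rightarrow> carrier G"
    proof
      fix j assume "j \<in> I"
      then show "f j \<in> carrier G" using assms(3) assms(4)[of j] by (cases "j = i") auto
    qed
  qed (use assms in auto)
  then show ?thesis using assms(3) by simp
qed

section \<open>Inverses in a groupoid\<close>

context groupoid
begin

lemma inverse_unique:
  assumes "g \<in> Mor Gr" "k \<in> Mor Gr" "Src Gr k = Tgt Gr g" "Tgt Gr k = Src Gr g"
      "Cmp Gr k g = Src Gr g"
    and "l \<in> Mor Gr" "Src Gr l = Tgt Gr g" "Tgt Gr l = Src Gr g" "Cmp Gr g l = Tgt Gr g"
  shows "k = l"
proof -
  have "k = Cmp Gr k (Cmp Gr g l)" using assms Cmp_Src[of k] by simp
  also have "\<dots> = Cmp Gr (Cmp Gr k g) l" using assms Cmp_assoc[of k g l] by simp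
  also have "\<dots> = l" using assms Cmp_Tgt[of l] by simp
  finally show ?thesis .
qed

lemma ginv_props:
  assumes "g \<in> Mor Gr"
  shows "ginv Gr g \<in> Mor Gr \<and> Src Gr (ginv Gr g) = Tgt Gr g \<and> Tgt Gr (ginv Gr g) = Src Gr g
      \<and> Cmp Gr g (ginv Gr g) = Tgt Gr g \<and> Cmp Gr (ginv Gr g) g = Src Gr g"
proof -
  obtain k where k: "k \<in> Mor Gr" "Src Gr k = Tgt Gr g" "Tgt Gr k = Src Gr g"
      "Cmp Gr g k = Tgt Gr g" "Cmp Gr k g = Src Gr g"
    using ex_inverse[OF assms] by blast
  have "ginv Gr g = k"
    unfolding ginv_def
  proof (rule the_equality)
    fix l assume "l \<in> Mor Gr \<and> Src Gr l = Tgt Gr g \<and> Tgt Gr l = Src Gr g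
      \<and> Cmp Gr g l = Tgt Gr g \<and> Cmp Gr l g = Src Gr g"
    then show "l = k" using assms k by (intro inverse_unique[of g l k]) simp_all
  qed (use k in simp)
  then show ?thesis using k by simp
qed

lemma ginv_Mor [simp]: "g \<in> Mor Gr \<Longrightarrow> ginv Gr g \<in> Mor Gr"
  and Src_ginv [simp]: "g \<in> Mor Gr \<Longrightarrow> Src Gr (ginv Gr g) = Tgt Gr g"
  and Tgt_ginv [simp]: "g \<in> Mor Gr \<Longrightarrow> Tgt Gr (ginv Gr g) = Src Gr g"
  and Cmp_ginv_right [simp]: "g \<in> Mor Gr \<Longrightarrow> Cmp Gr g (ginv Gr g) = Tgt Gr g"
  and Cmp_ginv_left [simp]: "g \<in> Mor Gr \<Longrightarrow> Cmp Gr (ginv Gr g) g = Src Gr g"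
  by (simp_all add: ginv_props)

lemma ginv_eqI:
  assumes "g \<in> Mor Gr" "k \<in> Mor Gr" "Src Gr k = Tgt Gr g" "Tgt Gr k = Src Gr g"
    "Cmp Gr k g = Src Gr g"
  shows "ginv Gr g = k"
  by (rule inverse_unique[of g k "ginv Gr g", symmetric]) (simp_all add: assms)

lemma ginv_ginv [simp]: "g \<in> Mor Gr \<Longrightarrow> ginv Gr (ginv Gr g) = g"
  by (rule ginv_eqI) auto

lemma Cmp_ginv_cancel_left:
  assumes "g \<in> Mor Gr" "k \<in> Mor Gr"
  shows "Src Gr g = Tgt Gr k \<Longrightarrow> Cmp Gr (ginv Gr g) (Cmp Gr g k) = k"
    and "Tgt Gr g = Tgt Gr k \<Longrightarrow> Cmp Gr g (Cmp Gr (ginv Gr g) k) = k"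
proof -
  assume gk: "Src Gr g = Tgt Gr k"
  have "Cmp Gr (ginv Gr g) (Cmp Gr g k) = Cmp Gr (Cmp Gr (ginv Gr g) g) k"
    by (rule Cmp_assoc[symmetric]) (simp_all add: assms gk)
  then show "Cmp Gr (ginv Gr g) (Cmp Gr g k) = k" by (simp add: assms gk Cmp_Tgt)
next
  assume gk: "Tgt Gr g = Tgt Gr k"
  have "Cmp Gr g (Cmp Gr (ginv Gr g) k) = Cmp Gr (Cmp Gr g (ginv Gr g)) k"
    by (rule Cmp_assoc[symmetric]) (simp_all add: assms gk)
  then show "Cmp Gr g (Cmp Gr (ginv Gr g) k) = k" by (simp add: assms gk Cmp_Tgt)
qed

lemma Cmp_ginv_cancel_right:
  assumes "g \<in> Mor Gr" "k \<in> Mor Gr"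
  shows "Src Gr g = Tgt Gr k \<Longrightarrow> Cmp Gr (Cmp Gr g k) (ginv Gr k) = g"
    and "Src Gr g = Src Gr k \<Longrightarrow> Cmp Gr (Cmp Gr g (ginv Gr k)) k = g"
proof -
  assume gk: "Src Gr g = Tgt Gr k"
  have "Cmp Gr (Cmp Gr g k) (ginv Gr k) = Cmp Gr g (Cmp Gr k (ginv Gr k))"
    by (rule Cmp_assoc) (simp_all add: assms gk)
  then show "Cmp Gr (Cmp Gr g k) (ginv Gr k) = g" by (simp add: assms gk[symmetric] Cmp_Src)
next
  assume gk: "Src Gr g = Src Gr k"
  have "Cmp Gr (Cmp Gr g (ginv Gr k)) k = Cmp Gr g (Cmp Gr (ginv Gr k) k)"
    by (rule Cmp_assoc) (simp_all add: assms gk)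
  then show "Cmp Gr (Cmp Gr g (ginv Gr k)) k = g" by (simp add: assms gk[symmetric] Cmp_Src)
qed

lemma ginv_Cmp:
  assumes "g \<in> Mor Gr" "k \<in> Mor Gr" "Src Gr g = Tgt Gr k"
  shows "ginv Gr (Cmp Gr g k) = Cmp Gr (ginv Gr k) (ginv Gr g)"
proof (rule ginv_eqI)
  show "Cmp Gr (Cmp Gr (ginv Gr k) (ginv Gr g)) (Cmp Gr g k) = Src Gr (Cmp Gr g k)"
    using assms by (simp add: Cmp_assoc Cmp_Mor Src_Cmp Tgt_Cmp Cmp_ginv_cancel_left)
qed (use assms in \<open>simp_all add: Cmp_Mor Src_Cmp Tgt_Cmp\<close>)

lemma Obj_Mor: "y \<in> Obj Gr \<Longrightarrow> y \<in> Mor Gr"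
  and Src_Obj: "y \<in> Obj Gr \<Longrightarrow> Src Gr y = y"
  and Tgt_Obj: "y \<in> Obj Gr \<Longrightarrow> Tgt Gr y = y"
  using Tgt_Src[of y] by (auto simp: Obj_def)

lemma Src_in_Obj: "g \<in> Mor Gr \<Longrightarrow> Src Gr g \<in> Obj Gr"
  and Tgt_in_Obj: "g \<in> Mor Gr \<Longrightarrow> Tgt Gr g \<in> Obj Gr"
  by (simp_all add: Obj_def Src_Mor Tgt_Mor Src_Src Src_Tgt)

lemma ginv_isotropy:
  assumes "x \<in> Obj Gr" "g \<in> hom_set Gr x x"
  shows "ginv (isotropy Gr x) g = ginv Gr g"
proof -
  interpret iso: groupoid "isotropy Gr x"
    using groupoid_isotropy[OF groupoid_axioms assms(1)] .
  show ?thesis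
    by (rule iso.ginv_eqI) (use assms in \<open>auto simp: isotropy_def hom_set_def\<close>)
qed

lemma Obj_isotropy: "x \<in> Obj Gr \<Longrightarrow> Obj (isotropy Gr x) = {x}"
  using Tgt_Obj[of x] by (auto simp: Obj_def isotropy_def hom_set_def)

end

lemma ginv_coarse:
  assumes "y \<in> Y" "z \<in> Y"
  shows "ginv (coarse Y) (y, z) = (z, y)"
  by (rule groupoid.ginv_eqI[OF groupoid_coarse]) (use assms in \<open>auto simp: coarse_def\<close>)

section \<open>Domains of a partial action\<close>

context partial_action
begin

lemma D_subset_Tgt: "g \<in> Mor Gr \<Longrightarrow> D g \<subseteq> D (Tgt Gr g)"
  using ideal_D[of g] by (auto simp: ideal_of_def)

lemma D_carrier: "g \<in> Mor Gr \<Longrightarrow> D g \<subseteq> carrier A"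
  using D_subset_Tgt[of g] ideal.Icarr[OF ideal_Tgt[of g]] by blast

lemma D_additive: "g \<in> Mor Gr \<Longrightarrow> additive_subgroup (D g) A"
  using ideal_D[of g] by (auto simp: ideal_of_def)

lemma D_zero: "g \<in> Mor Gr \<Longrightarrow> \<zero>\<^bsub>A\<^esub> \<in> D g"
  by (rule additive_subgroup.zero_closed[OF D_additive])

lemma D_add: "\<lbrakk>g \<in> Mor Gr; a \<in> D g; b \<in> D g\<rbrakk> \<Longrightarrow> a \<oplus>\<^bsub>A\<^esub> b \<in> D g"
  by (rule additive_subgroup.a_closed[OF D_additive])

lemma D_mult_right: "\<lbrakk>g \<in> Mor Gr; a \<in> D g; b \<in> D (Tgt Gr g)\<rbrakk> \<Longrightarrow> a \<otimes>\<^bsub>A\<^esub> b \<in> D g"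
  using ideal_D[of g] by (auto simp: ideal_of_def)

lemma action_in: "\<lbrakk>g \<in> Mor Gr; a \<in> D (ginv Gr g)\<rbrakk> \<Longrightarrow> \<alpha> g a \<in> D g"
  using iso_D[of g] by (auto simp: iso_between_def bij_betw_def)

lemma action_image: "g \<in> Mor Gr \<Longrightarrow> \<alpha> g ` D (ginv Gr g) = D g"
  using iso_D[of g] by (auto simp: iso_between_def bij_betw_def)

lemma action_add: "\<lbrakk>g \<in> Mor Gr; a \<in> D (ginv Gr g); b \<in> D (ginv Gr g)\<rbrakk>
    \<Longrightarrow> \<alpha> g (a \<oplus>\<^bsub>A\<^esub> b) = \<alpha> g a \<oplus>\<^bsub>A\<^esub> \<alpha> g b"
  and action_mult: "\<lbrakk>g \<in> Mor Gr; a \<in> D (ginv Gr g); b \<in> D (ginv Gr g)\<rbrakk>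
    \<Longrightarrow> \<alpha> g (a \<otimes>\<^bsub>A\<^esub> b) = \<alpha> g a \<otimes>\<^bsub>A\<^esub> \<alpha> g b"
  using iso_D[of g] by (auto simp: iso_between_def)

lemma action_zero: 
  assumes "g \<in> Mor Gr"
  shows "\<alpha> g \<zero>\<^bsub>A\<^esub> = \<zero>\<^bsub>A\<^esub>"
proof -
  have z: "\<zero>\<^bsub>A\<^esub> \<in> D (ginv Gr g)" using assms by (simp add: D_zero)
  have "\<alpha> g \<zero>\<^bsub>A\<^esub> \<in> carrier A" using action_in[OF assms z] D_carrier[OF assms] by blast
  moreover have "\<alpha> g \<zero>\<^bsub>A\<^esub> \<oplus>\<^bsub>A\<^esub> \<alpha> g \<zero>\<^bsub>A\<^esub> = \<alpha> g \<zero>\<^bsub>A\<^esub>"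
    using action_add[OF assms z z] by simp
  ultimately show ?thesis by (metis add.l_cancel_one' zero_closed)
qed

lemma action_ginv:
  assumes "g \<in> Mor Gr" "a \<in> D (ginv Gr g)"
  shows "\<alpha> (ginv Gr g) (\<alpha> g a) = a"
proof -
  have "a \<in> D (Src Gr g)" using assms D_subset_Tgt[of "ginv Gr g"] by auto
  then show ?thesis
    using action_Cmp[of "ginv Gr g" g a] assms action_in[of g a] action_Obj[OF Src_in_Obj]
    by simp
qed

text \<open>The axiom on preimages, read for \<open>g\<^sup>-\<^sup>1\<close> and \<open>k\<^sup>-\<^sup>1\<close>, bounds images: it yields the inclusion
  from left to right in the identity \<open>\<alpha>\<^sub>g(A\<^bsub>g\<^sup>-\<^sup>1\<^esub> \<inter> A\<^sub>k) = A\<^sub>g \<inter> A\<^bsub>gk\<^esub>\<close>.\<close>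

lemma action_in_Cmp:
  assumes "g \<in> Mor Gr" "k \<in> Mor Gr" "Src Gr g = Tgt Gr k"
    and a: "a \<in> D (ginv Gr g)" "a \<in> D k"
  shows "\<alpha> g a \<in> D (Cmp Gr g k)"
proof -
  have "\<alpha> g a \<in> D (ginv Gr (Cmp Gr (ginv Gr k) (ginv Gr g)))"
    using preimage_D[of "ginv Gr k" "ginv Gr g"] assms action_in[of g a] action_ginv[of g a]
    by auto
  then show ?thesis using assms by (simp add: ginv_Cmp)
qed

text \<open>Such a morphism acts globally. A group-type action supplies one from \<open>x\<close> to each object.\<close>

definition full :: "'g \<Rightarrow> bool" where
  "full k \<longleftrightarrow> k \<in> Mor Gr \<and> D k = D (Tgt Gr k) \<and> D (ginv Gr k) = D (Src Gr k)"

lemma full_Mor: "full k \<Longrightarrow> k \<in> Mor Gr"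
  by (simp add: full_def)

lemma full_ginv: "full k \<Longrightarrow> full (ginv Gr k)"
  by (auto simp: full_def)

text \<open>One inclusion holds because the domain of \<open>\<alpha>\<^sub>g\<close> lies inside \<open>A\<^sub>k\<close> if \<open>k\<close> is full; the other
  is the same inclusion for \<open>gk\<close> and \<open>k\<^sup>-\<^sup>1\<close>.\<close>

lemma D_Cmp_full_right:
  assumes g: "g \<in> Mor Gr" and k: "full k" and gk: "Src Gr g = Tgt Gr k"
  shows "D (Cmp Gr g k) = D g"
proof -
  have sub: "D g' \<subseteq> D (Cmp Gr g' k')"
    if g': "g' \<in> Mor Gr" and k': "full k'" and gk': "Src Gr g' = Tgt Gr k'" for g' k'
  proof
    fix b assume "b \<in> D g'"
    then obtain a where a: "a \<in> D (ginv Gr g')" "b = \<alpha> g' a"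
      using action_image[OF g'] by blast
    then have "a \<in> D k'"
      using g' k' gk' D_subset_Tgt[of "ginv Gr g'"] by (auto simp: full_def)
    then show "b \<in> D (Cmp Gr g' k')"
      using a action_in_Cmp g' k' gk' by (auto simp: full_def)
  qed
  have "D (Cmp Gr g k) \<subseteq> D (Cmp Gr (Cmp Gr g k) (ginv Gr k))"
    using assms by (intro sub) (auto simp: full_ginv full_Mor Cmp_Mor Src_Cmp)
  then show ?thesis
    using sub[OF g k gk] assms by (auto simp: Cmp_ginv_cancel_right full_Mor)
qed

lemma D_Cmp_full_left:
  assumes g: "g \<in> Mor Gr" and k: "full k" and kg: "Src Gr k = Tgt Gr g"
  shows "D (Cmp Gr k g) = \<alpha> k ` D g"
proof -
  have sub: "\<alpha> k' b \<in> D (Cmp Gr k' g')"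
    if "g' \<in> Mor Gr" "full k'" "Src Gr k' = Tgt Gr g'" "b \<in> D g'" for k' g' b
    using that D_subset_Tgt[of g'] by (intro action_in_Cmp) (auto simp: full_def)
  have "b \<in> \<alpha> k ` D g" if b: "b \<in> D (Cmp Gr k g)" for b
  proof -
    have "\<alpha> (ginv Gr k) b \<in> D (Cmp Gr (ginv Gr k) (Cmp Gr k g))"
      using assms b by (intro sub) (auto simp: full_ginv full_Mor Cmp_Mor Tgt_Cmp)
    moreover have "b \<in> D k"
      using b assms D_subset_Tgt[of "Cmp Gr k g"] by (auto simp: full_def Cmp_Mor Tgt_Cmp)
    then have "b = \<alpha> k (\<alpha> (ginv Gr k) b)"
      using action_ginv[of "ginv Gr k" b] full_Mor[OF k] by simp
    ultimately show ?thesis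
      using assms by (auto simp: Cmp_ginv_cancel_left full_Mor)
  qed
  then show ?thesis using sub[OF g k kg] by blast
qed

lemma action_Cmp_full_left:
  assumes "g \<in> Mor Gr" "full k" "Src Gr k = Tgt Gr g" "a \<in> D (ginv Gr g)"
  shows "\<alpha> (Cmp Gr k g) a = \<alpha> k (\<alpha> g a)"
  using assms action_in[of g a] D_subset_Tgt[of g] action_Cmp[of k g a]
  by (auto simp: full_def)

text \<open>The point is that \<open>\<alpha>\<^sub>k\<close> maps the domain of \<open>\<alpha>\<^bsub>gk\<^esub>\<close> into that of \<open>\<alpha>\<^sub>g\<close>, which is the
  description of the domain of \<open>(gk)\<^sup>-\<^sup>1 = k\<^sup>-\<^sup>1g\<^sup>-\<^sup>1\<close> given by the preceding lemmas.\<close>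

lemma action_Cmp_full_right:
  assumes "g \<in> Mor Gr" "full k" "Src Gr g = Tgt Gr k" "a \<in> D (ginv Gr (Cmp Gr g k))"
  shows "\<alpha> (Cmp Gr g k) a = \<alpha> g (\<alpha> k a)"
proof -
  have "D (ginv Gr (Cmp Gr g k)) = \<alpha> (ginv Gr k) ` D (ginv Gr g)"
    using assms by (simp add: ginv_Cmp full_Mor D_Cmp_full_left full_ginv)
  then obtain b where b: "b \<in> D (ginv Gr g)" "a = \<alpha> (ginv Gr k) b" using assms by auto
  have bk: "b \<in> D k"
    using b(1) assms D_subset_Tgt[of "ginv Gr g"] by (auto simp: full_def)
  have "\<alpha> k a = b" using b bk assms action_ginv[of "ginv Gr k" b] by (simp add: full_Mor)
  moreover have "a \<in> D (ginv Gr k)"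
    using b bk assms action_in[of "ginv Gr k" b] by (simp add: full_Mor)
  ultimately show ?thesis
    using action_Cmp[of g k a] assms b bk by (simp add: full_Mor)
qed

end

section \<open>The product of a skew groupoid ring\<close>

text \<open>The properties of a partial action on which the product of the skew ring depends: the
  structure of the coefficients is additive, and products matter only in how they meet the domains
  and zero. In this form a ring of formal sums can itself serve as the coefficients of a skew ring,
  whether or not its product is associative.\<close>

locale skew_data = groupoid Gr + abelian_monoid R
  for R :: "('b, 'r) ring_scheme" (structure) and Gr :: "'g groupoid"
    and D :: "'g \<Rightarrow> 'b set" and \<alpha> :: "'g \<Rightarrow> 'b \<Rightarrow> 'b" +
  assumes D_carrier: "g \<in> Mor Gr \<Longrightarrow> D g \<subseteq> carrier R"
    and D_zero: "g \<in> Mor Gr \<Longrightarrow> \<zero> \<in> D g"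
    and D_add: "\<lbrakk>g \<in> Mor Gr; a \<in> D g; b \<in> D g\<rbrakk> \<Longrightarrow> a \<oplus> b \<in> D g"
    and action_in: "\<lbrakk>g \<in> Mor Gr; a \<in> D (ginv Gr g)\<rbrakk> \<Longrightarrow> \<alpha> g a \<in> D g"
    and action_zero: "g \<in> Mor Gr \<Longrightarrow> \<alpha> g \<zero> = \<zero>"
    and mult_in: "\<lbrakk>g \<in> Mor Gr; k \<in> Mor Gr; Src Gr g = Tgt Gr k; a \<in> D (ginv Gr g); b \<in> D k\<rbrakk>
        \<Longrightarrow> a \<otimes> b \<in> D (ginv Gr g)"
    and mult_zero_left: "\<lbrakk>g \<in> Mor Gr; b \<in> D g\<rbrakk> \<Longrightarrow> \<zero> \<otimes> b = \<zero>"
    and mult_zero_right: "\<lbrakk>g \<in> Mor Gr; a \<in> D g\<rbrakk> \<Longrightarrow> a \<otimes> \<zero> = \<zero>"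
begin

abbreviation monomial_mult :: "'g \<Rightarrow> 'b \<Rightarrow> 'b \<Rightarrow> 'b" where
  "monomial_mult g a b \<equiv> \<alpha> g (\<alpha> (ginv Gr g) a \<otimes> b)"

lemma twist_in: "\<lbrakk>g \<in> Mor Gr; a \<in> D g\<rbrakk> \<Longrightarrow> \<alpha> (ginv Gr g) a \<in> D (ginv Gr g)"
  by (rule action_in) auto

lemma monomial_mult_in:
  "\<lbrakk>g \<in> Mor Gr; k \<in> Mor Gr; Src Gr g = Tgt Gr k; a \<in> D g; b \<in> D k\<rbrakk>
    \<Longrightarrow> monomial_mult g a b \<in> D g"
  by (intro action_in mult_in twist_in) auto

lemma monomial_mult_zero_left:
  "\<lbrakk>g \<in> Mor Gr; k \<in> Mor Gr; b \<in> D k\<rbrakk> \<Longrightarrow> monomial_mult g \<zero> b = \<zero>"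
  by (simp add: action_zero mult_zero_left)

lemma monomial_mult_zero_right:
  "\<lbrakk>g \<in> Mor Gr; a \<in> D g\<rbrakk> \<Longrightarrow> monomial_mult g a \<zero> = \<zero>"
  using mult_zero_right[OF _ twist_in] by (simp add: action_zero)

definition factorizations :: "'g \<Rightarrow> ('g \<times> 'g) set" where
  "factorizations m =
     {(g, k). g \<in> Mor Gr \<and> k \<in> Mor Gr \<and> Src Gr g = Tgt Gr k \<and> Cmp Gr g k = m}"

text \<open>The sum defining a coefficient of a product runs over the pairs in the two supports, an index
  set that varies with the factors. Any finite set of factorizations containing those pairs serves
  as well, and the choice can be adapted to a reindexing.\<close>

lemma skew_mult_eq:
  assumes f: "f \<in> carrier (skew_ring R Gr D \<alpha>)" and f': "f' \<in> carrier (skew_ring R Gr D \<alpha>)"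
    and P: "finite P" "P \<subseteq> factorizations m"
      "\<And>g k. \<lbrakk>(g, k) \<in> factorizations m; f g \<noteq> \<zero>; f' k \<noteq> \<zero>\<rbrakk> \<Longrightarrow> (g, k) \<in> P"
  shows "(f \<otimes>\<^bsub>skew_ring R Gr D \<alpha>\<^esub> f') m
      = finsum R (\<lambda>(g, k). monomial_mult g (f g) (f' k)) P"
proof -
  let ?S = "{(g, h). g \<in> Mor Gr \<and> h \<in> Mor Gr \<and> Src Gr g = Tgt Gr h \<and> Cmp Gr g h = m
           \<and> f g \<noteq> \<zero> \<and> f' h \<noteq> \<zero>}"
  have fD: "\<And>g. g \<in> Mor Gr \<Longrightarrow> f g \<in> D g" "\<And>g. g \<in> Mor Gr \<Longrightarrow> f' g \<in> D g"
    using f f' by (auto simp: skew_ring_def)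
  have "finsum R (\<lambda>(g, k). monomial_mult g (f g) (f' k)) ?S
      = finsum R (\<lambda>(g, k). monomial_mult g (f g) (f' k)) P"
  proof (rule add.finprod_mono_neutral_cong_left)
    show "?S \<subseteq> P" using P(3) by (auto simp: factorizations_def)
    show "(case i of (g, k) \<Rightarrow> monomial_mult g (f g) (f' k)) = \<zero>" if i: "i \<in> P - ?S" for i
    proof -
      obtain g k where i': "i = (g, k)" by (cases i)
      have gk: "(g, k) \<in> factorizations m" using i P(2) i' by auto
      then have mem: "g \<in> Mor Gr" "k \<in> Mor Gr" by (simp_all add: factorizations_def)
      have "f g = \<zero> \<or> f' k = \<zero>" using i i' gk by (auto simp: factorizations_def)
      then show ?thesis
        using monomial_mult_zero_left[OF mem fD(2)[OF mem(2)]]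
          monomial_mult_zero_right[OF mem(1) fD(1)[OF mem(1)]]
        unfolding i' by (elim disjE) simp_all
    qed
    show "(\<lambda>(g, k). monomial_mult g (f g) (f' k)) \<in> P \<rightarrow> carrier R"
    proof
      fix i assume "i \<in> P"
      moreover obtain g k where i': "i = (g, k)" by (cases i)
      ultimately have "(g, k) \<in> factorizations m" using P(2) by blast
      then have mem: "g \<in> Mor Gr" "k \<in> Mor Gr" "Src Gr g = Tgt Gr k"
        by (simp_all add: factorizations_def)
      show "(case i of (g, k) \<Rightarrow> monomial_mult g (f g) (f' k)) \<in> carrier R"
        using monomial_mult_in[OF mem fD(1)[OF mem(1)] fD(2)[OF mem(2)]] D_carrier[OF mem(1)]
        unfolding i' by auto
    qed
  qed (rule P(1), simp)
  then show ?thesis by (simp add: skew_ring_def)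
qed

lemma skew_mult_outside:
  assumes "f \<in> carrier (skew_ring R Gr D \<alpha>)" "f' \<in> carrier (skew_ring R Gr D \<alpha>)" "m \<notin> Mor Gr"
  shows "(f \<otimes>\<^bsub>skew_ring R Gr D \<alpha>\<^esub> f') m = \<zero>"
proof -
  have "factorizations m = {}" using assms(3) Cmp_Mor by (auto simp: factorizations_def)
  then show ?thesis using skew_mult_eq[OF assms(1,2), of "{}" m] by simp
qed

lemma skew_ring_carrier_iff:
  "f \<in> carrier (skew_ring R Gr D \<alpha>) \<longleftrightarrow>
     (\<forall>g\<in>Mor Gr. f g \<in> D g) \<and> (\<forall>g. g \<notin> Mor Gr \<longrightarrow> f g = \<zero>) \<and> finite {g. f g \<noteq> \<zero>}"
  by (simp add: skew_ring_def)

lemma abelian_monoid_skew_ring: "abelian_monoid (skew_ring R Gr D \<alpha>)"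
proof (rule abelian_monoidI)
  fix f f' assume f: "f \<in> carrier (skew_ring R Gr D \<alpha>)"
    and f': "f' \<in> carrier (skew_ring R Gr D \<alpha>)"
  have "finite {g. f g \<oplus> f' g \<noteq> \<zero>}"
  proof (rule finite_subset)
    show "{g. f g \<oplus> f' g \<noteq> \<zero>} \<subseteq> {g. f g \<noteq> \<zero>} \<union> {g. f' g \<noteq> \<zero>}"
      by auto
    show "finite ({g. f g \<noteq> \<zero>} \<union> {g. f' g \<noteq> \<zero>})"
      using f f' by (simp add: skew_ring_carrier_iff)
  qed
  then show "f \<oplus>\<^bsub>skew_ring R Gr D \<alpha>\<^esub> f' \<in> carrier (skew_ring R Gr D \<alpha>)"
    using D_add f f' by (simp add: skew_ring_def)
next
  have in_R: "f g \<in> carrier R" if "f \<in> carrier (skew_ring R Gr D \<alpha>)" for f g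
    using that D_carrier by (cases "g \<in> Mor Gr") (auto simp: skew_ring_def)
  {
    fix f f' f'' assume "f \<in> carrier (skew_ring R Gr D \<alpha>)" "f' \<in> carrier (skew_ring R Gr D \<alpha>)"
      "f'' \<in> carrier (skew_ring R Gr D \<alpha>)"
    then show "(f \<oplus>\<^bsub>skew_ring R Gr D \<alpha>\<^esub> f') \<oplus>\<^bsub>skew_ring R Gr D \<alpha>\<^esub> f''
        = f \<oplus>\<^bsub>skew_ring R Gr D \<alpha>\<^esub> (f' \<oplus>\<^bsub>skew_ring R Gr D \<alpha>\<^esub> f'')"
      using in_R by (simp add: skew_ring_def a_assoc fun_eq_iff)
  next
    fix f assume "f \<in> carrier (skew_ring R Gr D \<alpha>)"
    then show "\<zero>\<^bsub>skew_ring R Gr D \<alpha>\<^esub> \<oplus>\<^bsub>skew_ring R Gr D \<alpha>\<^esub> f = f"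
      using in_R[of f] by (simp add: skew_ring_def)
  next
    fix f f' assume "f \<in> carrier (skew_ring R Gr D \<alpha>)" "f' \<in> carrier (skew_ring R Gr D \<alpha>)"
    then show "f \<oplus>\<^bsub>skew_ring R Gr D \<alpha>\<^esub> f' = f' \<oplus>\<^bsub>skew_ring R Gr D \<alpha>\<^esub> f"
      using in_R[of f] in_R[of f'] by (simp add: skew_ring_def fun_eq_iff a_comm)
  }
qed (use D_zero in \<open>auto simp: skew_ring_def\<close>)

end

lemma identity_of_eqI:
  assumes "is_identity_of R I e"
  shows "identity_of R I = e"
  unfolding identity_of_def
proof (rule the_equality[where P = "is_identity_of R I"])
  fix e' assume e': "is_identity_of R I e'"
  have "e \<otimes>\<^bsub>R\<^esub> e' = e'" using assms e' unfolding is_identity_of_def by blast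
  moreover have "e \<otimes>\<^bsub>R\<^esub> e' = e" using assms e' unfolding is_identity_of_def by blast
  ultimately show "e' = e" by simp
qed (rule assms)

section \<open>Change of the coefficient ring\<close>

lemma skew_mult_apply:
  "(f \<otimes>\<^bsub>skew_ring R Gr D \<alpha>\<^esub> f') m = finsum R
     (\<lambda>(g, k). \<alpha> g (\<alpha> (ginv Gr g) (f g) \<otimes>\<^bsub>R\<^esub> f' k))
     {(g, k). g \<in> Mor Gr \<and> k \<in> Mor Gr \<and> Src Gr g = Tgt Gr k \<and> Cmp Gr g k = m
           \<and> f g \<noteq> \<zero>\<^bsub>R\<^esub> \<and> f' k \<noteq> \<zero>\<^bsub>R\<^esub>}"
  by (simp add: skew_ring_def)

lemma skew_add_apply: "(f \<oplus>\<^bsub>skew_ring R Gr D \<alpha>\<^esub> f') g = f g \<oplus>\<^bsub>R\<^esub> f' g"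
  and skew_one_apply: "\<one>\<^bsub>skew_ring R Gr D \<alpha>\<^esub> g =
      (if g \<in> Obj Gr then identity_of R (D g) else \<zero>\<^bsub>R\<^esub>)"
  by (simp_all add: skew_ring_def)

context skew_data
begin

text \<open>Functoriality in the coefficients: an additive and multiplicative bijection \<open>\<psi>\<close> that intertwines
  the actions may be applied to each coefficient. It preserves supports, so both products are sums
  over the same index set. Identity elements of the ideals at the objects are carried along since
  they are determined by their defining property.\<close>

lemma skew_ring_iso_transport:
  fixes S :: "('c, 's) ring_scheme" and \<psi> :: "'b \<Rightarrow> 'c"
  assumes S: "abelian_monoid S"
    and bij: "bij_betw \<psi> (carrier R) (carrier S)"
    and \<psi>_zero: "\<psi> \<zero> = \<zero>\<^bsub>S\<^esub>"
    and \<psi>_add: "\<And>a b. \<lbrakk>a \<in> carrier R; b \<in> carrier R\<rbrakk> \<Longrightarrow> \<psi> (a \<oplus> b) = \<psi> a \<oplus>\<^bsub>S\<^esub> \<psi> b"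
    and \<psi>_mult: "\<And>a b. \<lbrakk>a \<in> carrier R; b \<in> carrier R\<rbrakk> \<Longrightarrow> \<psi> (a \<otimes> b) = \<psi> a \<otimes>\<^bsub>S\<^esub> \<psi> b"
    and D': "\<And>g. g \<in> Mor Gr \<Longrightarrow> D' g = \<psi> ` D g"
    and \<alpha>': "\<And>g a. \<lbrakk>g \<in> Mor Gr; a \<in> D (ginv Gr g)\<rbrakk> \<Longrightarrow> \<alpha>' g (\<psi> a) = \<psi> (\<alpha> g a)"
    and unital: "\<And>y. y \<in> Obj Gr \<Longrightarrow> unital R (D y)"
  shows "skew_ring R Gr D \<alpha> \<simeq> skew_ring S Gr D' \<alpha>'"
proof -
  let ?X = "skew_ring R Gr D \<alpha>" and ?Y = "skew_ring S Gr D' \<alpha>'"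
  define \<Psi> where "\<Psi> f = (\<lambda>g. \<psi> (f g))" for f :: "'g \<Rightarrow> 'b"
  let ?inv = "inv_into (carrier R) \<psi>"
  have inj: "inj_on \<psi> (carrier R)" using bij by (rule bij_betw_imp_inj_on)
  have in_S: "\<psi> a \<in> carrier S" if "a \<in> carrier R" for a
    using bij that by (rule bij_betwE[rule_format])
  have \<psi>_eq_zero: "\<psi> a = \<zero>\<^bsub>S\<^esub> \<longleftrightarrow> a = \<zero>" if "a \<in> carrier R" for a
    using inj_on_eq_iff[OF inj that zero_closed] \<psi>_zero by simp
  have X_in: "f g \<in> carrier R" if "f \<in> carrier ?X" for f g
    using that D_carrier[of g] by (cases "g \<in> Mor Gr") (auto simp: skew_ring_carrier_iff)
  have X_D: "f g \<in> D g" if "f \<in> carrier ?X" "g \<in> Mor Gr" for f g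
    using that by (simp add: skew_ring_carrier_iff)
  have Y_iff: "F \<in> carrier ?Y \<longleftrightarrow> (\<forall>g\<in>Mor Gr. F g \<in> D' g) \<and> (\<forall>g. g \<notin> Mor Gr \<longrightarrow> F g = \<zero>\<^bsub>S\<^esub>)
      \<and> finite {g. F g \<noteq> \<zero>\<^bsub>S\<^esub>}" for F
    by (simp add: skew_ring_def)
  have supp: "{g. \<psi> (f g) \<noteq> \<zero>\<^bsub>S\<^esub>} = {g. f g \<noteq> \<zero>}" if "f \<in> carrier ?X" for f
    using \<psi>_eq_zero X_in[OF that] by simp
  have bij_\<Psi>: "bij_betw \<Psi> (carrier ?X) (carrier ?Y)"
  proof (rule bij_betw_byWitness[where f' = "\<lambda>F g. ?inv (F g)"])
    show "\<forall>f\<in>carrier ?X. (\<lambda>g. ?inv (\<Psi> f g)) = f"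
      using X_in inj by (simp add: \<Psi>_def)
    have inv_D: "?inv (F g) \<in> D g \<and> \<psi> (?inv (F g)) = F g" if "F \<in> carrier ?Y" "g \<in> Mor Gr" for F g
    proof -
      have "F g \<in> D' g" using that unfolding Y_iff by blast
      then have "F g \<in> \<psi> ` D g" unfolding D'[OF that(2)] .
      then obtain a where a: "a \<in> D g" "F g = \<psi> a" by blast
      moreover have "a \<in> carrier R" using a(1) D_carrier[OF that(2)] by blast
      ultimately show ?thesis using inj by simp
    qed
    have inv_zero: "?inv \<zero>\<^bsub>S\<^esub> = \<zero>"
      using inv_into_f_f[OF inj zero_closed] \<psi>_zero by simp
    have inv_out: "?inv (F g) = \<zero>" "F g = \<zero>\<^bsub>S\<^esub>" if "F \<in> carrier ?Y" "g \<notin> Mor Gr" for F g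
      using that inv_zero by (simp_all add: Y_iff)
    show "\<forall>F\<in>carrier ?Y. \<Psi> (\<lambda>g. ?inv (F g)) = F"
    proof (intro ballI ext)
      fix F g assume "F \<in> carrier ?Y"
      then show "\<Psi> (\<lambda>g. ?inv (F g)) g = F g"
        using inv_D[of F g] inv_out[of F g] \<psi>_zero by (cases "g \<in> Mor Gr") (simp_all add: \<Psi>_def)
    qed
    show "\<Psi> ` carrier ?X \<subseteq> carrier ?Y"
    proof
      fix F assume "F \<in> \<Psi> ` carrier ?X"
      then obtain f where f: "f \<in> carrier ?X" "F = \<Psi> f" by blast
      then show "F \<in> carrier ?Y"
        unfolding Y_iff f(2) \<Psi>_def supp[OF f(1)]
        using D' \<psi>_zero by (simp add: skew_ring_carrier_iff)
    qed
    show "(\<lambda>F g. ?inv (F g)) ` carrier ?Y \<subseteq> carrier ?X"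
    proof
      fix f assume "f \<in> (\<lambda>F g. ?inv (F g)) ` carrier ?Y"
      then obtain F where F: "F \<in> carrier ?Y" "f = (\<lambda>g. ?inv (F g))" by blast
      have "finite {g. ?inv (F g) \<noteq> \<zero>}"
      proof (rule finite_subset)
        show "{g. ?inv (F g) \<noteq> \<zero>} \<subseteq> {g. F g \<noteq> \<zero>\<^bsub>S\<^esub>}" using inv_zero by auto
        show "finite {g. F g \<noteq> \<zero>\<^bsub>S\<^esub>}" using F(1) by (simp add: Y_iff)
      qed
      then show "f \<in> carrier ?X"
        using inv_D[OF F(1)] inv_out[OF F(1)] by (simp add: skew_ring_carrier_iff F(2))
    qed
  qed
  have "\<Psi> \<in> ring_iso ?X ?Y"
  proof (rule ring_iso_memI)
    show "\<Psi> f \<in> carrier ?Y" if "f \<in> carrier ?X" for f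
      using bij_\<Psi> that by (rule bij_betwE[rule_format])
    show "\<Psi> (f \<otimes>\<^bsub>?X\<^esub> f') = \<Psi> f \<otimes>\<^bsub>?Y\<^esub> \<Psi> f'" if f: "f \<in> carrier ?X" and f': "f' \<in> carrier ?X" for f f'
    proof
      fix m
      let ?P = "{(g, k). g \<in> Mor Gr \<and> k \<in> Mor Gr \<and> Src Gr g = Tgt Gr k \<and> Cmp Gr g k = m
           \<and> f g \<noteq> \<zero> \<and> f' k \<noteq> \<zero>}"
      let ?t = "\<lambda>(g, k). monomial_mult g (f g) (f' k)"
      have P_eq: "?P = {(g, k). g \<in> Mor Gr \<and> k \<in> Mor Gr \<and> Src Gr g = Tgt Gr k \<and> Cmp Gr g k = m
           \<and> \<Psi> f g \<noteq> \<zero>\<^bsub>S\<^esub> \<and> \<Psi> f' k \<noteq> \<zero>\<^bsub>S\<^esub>}"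
        using \<psi>_eq_zero[OF X_in[OF f]] \<psi>_eq_zero[OF X_in[OF f']] by (simp add: \<Psi>_def)
      have fin: "finite ?P"
        by (rule finite_subset[of _ "{g. f g \<noteq> \<zero>} \<times> {k. f' k \<noteq> \<zero>}"])
          (use f f' in \<open>auto simp: skew_ring_carrier_iff\<close>)
      have t: "?t p \<in> carrier R \<and> \<psi> (?t p)
          = (\<lambda>(g, k). \<alpha>' g (\<alpha>' (ginv Gr g) (\<Psi> f g) \<otimes>\<^bsub>S\<^esub> \<Psi> f' k)) p" if p: "p \<in> ?P" for p
      proof -
        obtain g k where gk: "p = (g, k)" "g \<in> Mor Gr" "k \<in> Mor Gr" "Src Gr g = Tgt Gr k"
          using p by auto
        note fg = X_D[OF f gk(2)] and fk = X_D[OF f' gk(3)]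
        note tw = twist_in[OF gk(2) fg]
        note twR = subsetD[OF D_carrier[OF ginv_Mor[OF gk(2)]] tw]
        have 1: "\<alpha>' (ginv Gr g) (\<psi> (f g)) = \<psi> (\<alpha> (ginv Gr g) (f g))"
          using \<alpha>'[of "ginv Gr g" "f g"] gk(2) fg by simp
        have 2: "\<psi> (\<alpha> (ginv Gr g) (f g)) \<otimes>\<^bsub>S\<^esub> \<psi> (f' k) = \<psi> (\<alpha> (ginv Gr g) (f g) \<otimes> f' k)"
          using \<psi>_mult[OF twR X_in[OF f']] by simp
        have 3: "\<alpha>' g (\<psi> (\<alpha> (ginv Gr g) (f g) \<otimes> f' k)) = \<psi> (monomial_mult g (f g) (f' k))"
          by (rule \<alpha>'[OF gk(2) mult_in[OF gk(2-4) tw fk]])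
        show ?thesis
          using monomial_mult_in[OF gk(2-4) fg fk] D_carrier[OF gk(2)]
          by (auto simp: gk(1) \<Psi>_def 1 2 3)
      qed
      have "\<psi> (finsum R ?t ?P) = finsum S (\<lambda>p. \<psi> (?t p)) ?P"
        by (rule conjunct2[OF finsum_additive_on[OF abelian_monoid_axioms S, where H = "carrier R"]])
          (simp_all add: in_S \<psi>_zero \<psi>_add fin conjunct1[OF t] del: mem_Collect_eq split_paired_All)
      also have "\<dots> = finsum S (\<lambda>(g, k). \<alpha>' g (\<alpha>' (ginv Gr g) (\<Psi> f g) \<otimes>\<^bsub>S\<^esub> \<Psi> f' k)) ?P"
      proof (rule abelian_monoid.finsum_cong'[OF S refl])
        show "(\<lambda>(g, k). \<alpha>' g (\<alpha>' (ginv Gr g) (\<Psi> f g) \<otimes>\<^bsub>S\<^esub> \<Psi> f' k)) \<in> ?P \<rightarrow> carrier S"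
        proof
          fix p assume p: "p \<in> ?P"
          show "(\<lambda>(g, k). \<alpha>' g (\<alpha>' (ginv Gr g) (\<Psi> f g) \<otimes>\<^bsub>S\<^esub> \<Psi> f' k)) p \<in> carrier S"
            using in_S[OF conjunct1[OF t[OF p]]] unfolding conjunct2[OF t[OF p]] .
        qed
        show "\<psi> (?t p) = (\<lambda>(g, k). \<alpha>' g (\<alpha>' (ginv Gr g) (\<Psi> f g) \<otimes>\<^bsub>S\<^esub> \<Psi> f' k)) p" if "p \<in> ?P" for p
          using t[OF that] by (rule conjunct2)
      qed
      finally show "\<Psi> (f \<otimes>\<^bsub>?X\<^esub> f') m = (\<Psi> f \<otimes>\<^bsub>?Y\<^esub> \<Psi> f') m"
        unfolding skew_mult_apply P_eq[symmetric] by (simp only: \<Psi>_def skew_mult_apply)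
    qed
    show "\<Psi> (f \<oplus>\<^bsub>?X\<^esub> f') = \<Psi> f \<oplus>\<^bsub>?Y\<^esub> \<Psi> f'" if "f \<in> carrier ?X" "f' \<in> carrier ?X" for f f'
      using \<psi>_add[OF X_in[OF that(1)] X_in[OF that(2)]] by (simp add: \<Psi>_def fun_eq_iff skew_add_apply)
    show "\<Psi> \<one>\<^bsub>?X\<^esub> = \<one>\<^bsub>?Y\<^esub>"
    proof
      fix y
      have "\<psi> (identity_of R (D y)) = identity_of S (D' y)" if y: "y \<in> Obj Gr"
      proof -
        obtain e where e: "is_identity_of R (D y) e" using unital[OF y] by (auto simp: unital_def)
        have sub: "D y \<subseteq> carrier R" using D_carrier[OF Obj_Mor[OF y]] .
        have "is_identity_of S (\<psi> ` D y) (\<psi> e)"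
          unfolding is_identity_of_def
        proof (intro conjI ballI)
          show "\<psi> e \<in> \<psi> ` D y" using e by (simp add: is_identity_of_def)
          fix b assume "b \<in> \<psi> ` D y"
          then obtain a where a: "a \<in> D y" "b = \<psi> a" by blast
          have ae: "a \<in> carrier R" "e \<in> carrier R" "e \<otimes> a = a" "a \<otimes> e = a"
            using a e sub by (auto simp: is_identity_of_def)
          show "\<psi> e \<otimes>\<^bsub>S\<^esub> b = b" "b \<otimes>\<^bsub>S\<^esub> \<psi> e = b"
            using \<psi>_mult[of e a] \<psi>_mult[of a e] ae a(2) by simp_all
        qed
        then show ?thesis
          by (simp add: identity_of_eqI[OF e] identity_of_eqI D'[OF Obj_Mor[OF y]])
      qed
      then show "\<Psi> \<one>\<^bsub>?X\<^esub> y = \<one>\<^bsub>?Y\<^esub> y" by (simp add: \<Psi>_def skew_one_apply \<psi>_zero)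
    qed
    show "bij_betw \<Psi> (carrier ?X) (carrier ?Y)" by (rule bij_\<Psi>)
  qed
  then show ?thesis by (auto simp: is_ring_iso_def)
qed

end

section \<open>Group-type partial actions\<close>

locale group_type_action = partial_action A Gr D \<alpha>
  for A :: "('a, 'm) ring_scheme" and Gr :: "'g groupoid"
    and D :: "'g \<Rightarrow> 'a set" and \<alpha> :: "'g \<Rightarrow> 'a \<Rightarrow> 'a" +
  fixes x :: 'g and h :: "'g \<Rightarrow> 'g"
  assumes group_type: "group_type Gr D x h"
    and finite_Obj: "finite (Obj Gr)"
    and unital_D: "y \<in> Obj Gr \<Longrightarrow> unital A (D y)"
begin

abbreviation "Y \<equiv> Obj Gr"
abbreviation "G \<equiv> hom_set Gr x x"
abbreviation "\<theta> y \<equiv> \<alpha> (h y)"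
abbreviation "\<theta>' y \<equiv> \<alpha> (ginv Gr (h y))"
abbreviation "C \<equiv> coarse_skew_ring A Gr D \<alpha> h"

lemma x_Obj: "x \<in> Y"
  using group_type by (simp add: group_type_def)

lemma h_Mor [simp]: "y \<in> Y \<Longrightarrow> h y \<in> Mor Gr"
  and Src_h [simp]: "y \<in> Y \<Longrightarrow> Src Gr (h y) = x"
  and Tgt_h [simp]: "y \<in> Y \<Longrightarrow> Tgt Gr (h y) = y"
  and D_h: "y \<in> Y \<Longrightarrow> D (h y) = D y"
  and D_ginv_h: "y \<in> Y \<Longrightarrow> D (ginv Gr (h y)) = D x"
  using group_type by (simp_all add: group_type_def hom_set_def)

lemma full_h: "y \<in> Y \<Longrightarrow> full (h y)"
  by (simp add: full_def D_h D_ginv_h)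

lemma loop_Mor: "k \<in> G \<Longrightarrow> k \<in> Mor Gr"
  and Src_loop: "k \<in> G \<Longrightarrow> Src Gr k = x"
  and Tgt_loop: "k \<in> G \<Longrightarrow> Tgt Gr k = x"
  by (simp_all add: hom_set_def)

lemmas loop = loop_Mor Src_loop Tgt_loop

lemma ginv_loop: "k \<in> G \<Longrightarrow> ginv Gr k \<in> G"
  and Cmp_loop: "\<lbrakk>k \<in> G; l \<in> G\<rbrakk> \<Longrightarrow> Cmp Gr k l \<in> G"
  by (simp_all add: hom_set_def Cmp_Mor Src_Cmp Tgt_Cmp)

lemma x_loop: "x \<in> G"
  using x_Obj by (simp add: hom_set_def Obj_Mor Src_Obj Tgt_Obj)

lemma D_loop: "k \<in> G \<Longrightarrow> D k \<subseteq> D x"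
  using D_subset_Tgt[of k] by (simp add: loop)

section \<open>Transport along the chosen morphisms\<close>

lemma \<theta>_in: "\<lbrakk>y \<in> Y; a \<in> D x\<rbrakk> \<Longrightarrow> \<theta> y a \<in> D y"
  using action_in[of "h y" a] by (simp add: D_h D_ginv_h)

lemma \<theta>'_in: "\<lbrakk>y \<in> Y; a \<in> D y\<rbrakk> \<Longrightarrow> \<theta>' y a \<in> D x"
  using action_in[of "ginv Gr (h y)" a] by (simp add: D_h D_ginv_h)

lemma \<theta>'_\<theta>: "\<lbrakk>y \<in> Y; a \<in> D x\<rbrakk> \<Longrightarrow> \<theta>' y (\<theta> y a) = a"
  using action_ginv[of "h y" a] by (simp add: D_ginv_h)

lemma \<theta>_\<theta>': "\<lbrakk>y \<in> Y; a \<in> D y\<rbrakk> \<Longrightarrow> \<theta> y (\<theta>' y a) = a"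
  using action_ginv[of "ginv Gr (h y)" a] by (simp add: D_h)

lemma \<theta>_add: "\<lbrakk>y \<in> Y; a \<in> D x; b \<in> D x\<rbrakk> \<Longrightarrow> \<theta> y (a \<oplus>\<^bsub>A\<^esub> b) = \<theta> y a \<oplus>\<^bsub>A\<^esub> \<theta> y b"
  and \<theta>_mult: "\<lbrakk>y \<in> Y; a \<in> D x; b \<in> D x\<rbrakk> \<Longrightarrow> \<theta> y (a \<otimes>\<^bsub>A\<^esub> b) = \<theta> y a \<otimes>\<^bsub>A\<^esub> \<theta> y b"
  by (simp_all add: action_add action_mult D_ginv_h)

lemma \<theta>'_add: "\<lbrakk>y \<in> Y; a \<in> D y; b \<in> D y\<rbrakk> \<Longrightarrow> \<theta>' y (a \<oplus>\<^bsub>A\<^esub> b) = \<theta>' y a \<oplus>\<^bsub>A\<^esub> \<theta>' y b"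
  and \<theta>'_mult: "\<lbrakk>y \<in> Y; a \<in> D y; b \<in> D y\<rbrakk> \<Longrightarrow> \<theta>' y (a \<otimes>\<^bsub>A\<^esub> b) = \<theta>' y a \<otimes>\<^bsub>A\<^esub> \<theta>' y b"
  by (simp_all add: action_add action_mult D_h)

lemma \<theta>_zero: "y \<in> Y \<Longrightarrow> \<theta> y \<zero>\<^bsub>A\<^esub> = \<zero>\<^bsub>A\<^esub>"
  and \<theta>'_zero: "y \<in> Y \<Longrightarrow> \<theta>' y \<zero>\<^bsub>A\<^esub> = \<zero>\<^bsub>A\<^esub>"
  by (simp_all add: action_zero)

lemma D_Obj_carrier: "y \<in> Y \<Longrightarrow> a \<in> D y \<Longrightarrow> a \<in> carrier A"
  using D_carrier[OF Obj_Mor] by blast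

lemma D_Obj_mult: "\<lbrakk>y \<in> Y; a \<in> D y; b \<in> D y\<rbrakk> \<Longrightarrow> a \<otimes>\<^bsub>A\<^esub> b \<in> D y"
  using D_mult_right[OF Obj_Mor] by (simp add: Tgt_Obj)

text \<open>Membership in the transported ideal is tested on the coordinate in \<open>A\<^sub>x\<close>; this form is the one
  to compute with.\<close>

lemma image_\<theta>_iff:
  assumes "k \<in> G" "y \<in> Y"
  shows "a \<in> \<theta> y ` D k \<longleftrightarrow> a \<in> D y \<and> \<theta>' y a \<in> D k"
proof
  assume "a \<in> \<theta> y ` D k"
  then obtain b where b: "b \<in> D k" "a = \<theta> y b" by blast
  moreover have "b \<in> D x" using b(1) D_loop[OF assms(1)] by blast
  ultimately show "a \<in> D y \<and> \<theta>' y a \<in> D k" using assms(2) by (simp add: \<theta>_in \<theta>'_\<theta>)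
next
  assume a: "a \<in> D y \<and> \<theta>' y a \<in> D k"
  then have "\<theta> y (\<theta>' y a) = a" using \<theta>_\<theta>' assms(2) by blast
  then show "a \<in> \<theta> y ` D k" using a by (metis imageI)
qed

section \<open>Morphisms as triples of a source, a target and a loop\<close>

text \<open>The factorization \<open>g = h\<^sub>z k h\<^sub>y\<^sup>-\<^sup>1\<close> of a morphism \<open>g : y \<rightarrow> z\<close>, read in both directions.\<close>

definition arrow :: "'g \<Rightarrow> 'g \<Rightarrow> 'g \<Rightarrow> 'g" where
  "arrow y z k = Cmp Gr (h z) (Cmp Gr k (ginv Gr (h y)))"

definition loop_of :: "'g \<Rightarrow> 'g" where
  "loop_of g = Cmp Gr (ginv Gr (h (Tgt Gr g))) (Cmp Gr g (h (Src Gr g)))"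

lemma arrow_Mor: "\<lbrakk>y \<in> Y; z \<in> Y; k \<in> G\<rbrakk> \<Longrightarrow> arrow y z k \<in> Mor Gr"
  and Src_arrow: "\<lbrakk>y \<in> Y; z \<in> Y; k \<in> G\<rbrakk> \<Longrightarrow> Src Gr (arrow y z k) = y"
  and Tgt_arrow: "\<lbrakk>y \<in> Y; z \<in> Y; k \<in> G\<rbrakk> \<Longrightarrow> Tgt Gr (arrow y z k) = z"
  by (simp_all add: arrow_def Cmp_Mor Src_Cmp Tgt_Cmp loop)

lemma loop_of_in: "g \<in> Mor Gr \<Longrightarrow> loop_of g \<in> G"
  by (simp add: loop_of_def hom_set_def Cmp_Mor Src_Cmp Tgt_Cmp Src_in_Obj Tgt_in_Obj)

lemma arrow_loop_of:
  assumes "g \<in> Mor Gr"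
  shows "arrow (Src Gr g) (Tgt Gr g) (loop_of g) = g"
  using assms
  by (simp add: loop_of_def arrow_def Cmp_assoc Cmp_Mor Src_Cmp Tgt_Cmp Src_in_Obj Tgt_in_Obj
      Cmp_ginv_cancel_left Cmp_Src)

lemma loop_of_arrow:
  assumes "y \<in> Y" "z \<in> Y" "k \<in> G"
  shows "loop_of (arrow y z k) = k"
  unfolding loop_of_def Src_arrow[OF assms] Tgt_arrow[OF assms]
  using assms Cmp_Src[of k]
  by (simp add: arrow_def Cmp_assoc Cmp_Mor Src_Cmp Tgt_Cmp loop Cmp_ginv_cancel_left)

lemma arrow_inj:
  assumes "arrow y z k = arrow y' z' k'"
    and "y \<in> Y" "z \<in> Y" "k \<in> G" "y' \<in> Y" "z' \<in> Y" "k' \<in> G"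
  shows "y = y'" "z = z'" "k = k'"
  using arg_cong[OF assms(1), of "Src Gr"] arg_cong[OF assms(1), of "Tgt Gr"]
    arg_cong[OF assms(1), of loop_of]
  by (simp_all add: Src_arrow Tgt_arrow loop_of_arrow assms(2-))

lemma Cmp_arrow:
  assumes "w \<in> Y" "y \<in> Y" "z \<in> Y" "k \<in> G" "l \<in> G"
  shows "Cmp Gr (arrow y z k) (arrow w y l) = arrow w z (Cmp Gr k l)"
  using assms
  by (simp add: arrow_def Cmp_assoc Cmp_Mor Src_Cmp Tgt_Cmp loop Cmp_ginv_cancel_left)

lemma ginv_arrow:
  assumes "y \<in> Y" "z \<in> Y" "k \<in> G"
  shows "ginv Gr (arrow y z k) = arrow z y (ginv Gr k)"
  using assms
  by (simp add: arrow_def ginv_Cmp Cmp_assoc Cmp_Mor Src_Cmp Tgt_Cmp loop)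

text \<open>This matches the supports of the two identity elements: the identities of the groupoid
  correspond to the diagonal pairs \<open>(y, y)\<close> together with the identity of \<open>G\<close>.\<close>

lemma arrow_Obj_iff:
  assumes "y \<in> Y" "z \<in> Y" "k \<in> G"
  shows "arrow y z k \<in> Y \<longleftrightarrow> y = z \<and> k = x"
proof
  assume o: "arrow y z k \<in> Y"
  have yz: "arrow y z k = y" "arrow y z k = z"
    using Src_Obj[OF o] Tgt_Obj[OF o] Src_arrow[OF assms] Tgt_arrow[OF assms] by simp_all
  have "k = loop_of y" using loop_of_arrow[OF assms] yz by simp
  also have "\<dots> = x"
    using assms Cmp_Tgt[of "h y"] by (simp add: loop_of_def Obj_Mor Src_Obj Tgt_Obj)
  finally show "y = z \<and> k = x" using yz by simp
next
  assume "y = z \<and> k = x"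
  moreover have "arrow y y x = y"
    using assms Cmp_Tgt[of "ginv Gr (h y)"] by (simp add: arrow_def)
  ultimately show "arrow y z k \<in> Y" using assms by simp
qed

text \<open>The outer factors \<open>h\<^sub>z\<close> and \<open>h\<^sub>y\<^sup>-\<^sup>1\<close> are full: the right one leaves the domain unchanged and the
  left one transports it.\<close>

lemma D_arrow:
  assumes "y \<in> Y" "z \<in> Y" "k \<in> G"
  shows "D (arrow y z k) = \<theta> z ` D k"
  unfolding arrow_def using assms
  by (simp add: D_Cmp_full_left D_Cmp_full_right full_h full_ginv loop Cmp_Mor Tgt_Cmp)

lemma action_arrow:
  assumes "y \<in> Y" "z \<in> Y" "k \<in> G" "a \<in> D (ginv Gr k)"
  shows "\<alpha> (arrow y z k) (\<theta> y a) = \<theta> z (\<alpha> k a)"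
proof -
  let ?m = "Cmp Gr k (ginv Gr (h y))"
  have m: "?m \<in> Mor Gr" "Tgt Gr ?m = x" using assms by (simp_all add: Cmp_Mor Tgt_Cmp loop)
  have "D (ginv Gr ?m) = \<theta> y ` D (ginv Gr k)"
    using assms by (simp add: ginv_Cmp loop D_Cmp_full_left full_h)
  then have am: "\<theta> y a \<in> D (ginv Gr ?m)" using assms by simp
  have "\<alpha> (arrow y z k) (\<theta> y a) = \<theta> z (\<alpha> ?m (\<theta> y a))"
    unfolding arrow_def using assms m am by (intro action_Cmp_full_left) (simp_all add: full_h)
  also have "\<alpha> ?m (\<theta> y a) = \<alpha> k (\<theta>' y (\<theta> y a))"
    using assms am by (intro action_Cmp_full_right) (simp_all add: full_h full_ginv loop)
  also have "\<theta>' y (\<theta> y a) = a"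
    using assms D_loop[OF ginv_loop[OF assms(3)]] by (intro \<theta>'_\<theta>) auto
  finally show ?thesis .
qed

text \<open>In coordinates over \<open>A\<^sub>x\<close>, the product of two monomials of \<open>A * Gr\<close> is the product of monomials
  for the partial action of \<open>G\<close> on \<open>A\<^sub>x\<close>; the objects enter only through the outer \<open>\<theta>\<^sub>z\<close>.\<close>

lemma monomial_mult_arrow:
  assumes "y \<in> Y" "z \<in> Y" "k \<in> G" "a \<in> D k" "b \<in> D x"
  shows "\<alpha> (arrow y z k) (\<alpha> (ginv Gr (arrow y z k)) (\<theta> z a) \<otimes>\<^bsub>A\<^esub> \<theta> y b)
    = \<theta> z (\<alpha> k (\<alpha> (ginv Gr k) a \<otimes>\<^bsub>A\<^esub> b))"
proof -
  let ?c = "\<alpha> (ginv Gr k) a"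
  have c: "?c \<in> D (ginv Gr k)" using assms by (intro action_in) (simp_all add: loop)
  have cb: "?c \<otimes>\<^bsub>A\<^esub> b \<in> D (ginv Gr k)"
    using c assms by (intro D_mult_right) (simp_all add: loop)
  have "\<alpha> (ginv Gr (arrow y z k)) (\<theta> z a) = \<theta> y ?c"
    using assms by (simp add: ginv_arrow action_arrow ginv_loop loop)
  also have "\<dots> \<otimes>\<^bsub>A\<^esub> \<theta> y b = \<theta> y (?c \<otimes>\<^bsub>A\<^esub> b)"
    using assms c D_loop[OF ginv_loop[OF assms(3)]] by (subst \<theta>_mult) auto
  finally show ?thesis using action_arrow[OF assms(1-3) cb] by simp
qed

section \<open>The coarse skew groupoid ring\<close>

lemma skew_data_coarse: "skew_data A (coarse Y) (beta_dom D) (beta_map Gr \<alpha> h)"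
proof (intro skew_data.intro groupoid_coarse abelian_monoid_axioms skew_data_axioms.intro)
  fix u v assume u: "u \<in> Mor (coarse Y)" 
  then obtain y z where yz: "u = (y, z)" "y \<in> Y" "z \<in> Y" by (auto simp: coarse_def)
  show "beta_dom D u \<subseteq> carrier A" "\<zero>\<^bsub>A\<^esub> \<in> beta_dom D u"
    using yz D_zero[OF Obj_Mor] D_Obj_carrier by (auto simp: beta_dom_def)
  show "a \<oplus>\<^bsub>A\<^esub> b \<in> beta_dom D u" if "a \<in> beta_dom D u" "b \<in> beta_dom D u" for a b
    using yz that D_add[OF Obj_Mor] by (simp add: beta_dom_def)
  show "beta_map Gr \<alpha> h u a \<in> beta_dom D u" if "a \<in> beta_dom D (ginv (coarse Y) u)" for a
    using yz that by (simp add: beta_dom_def beta_map_def ginv_coarse \<theta>_in \<theta>'_in)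
  show "beta_map Gr \<alpha> h u \<zero>\<^bsub>A\<^esub> = \<zero>\<^bsub>A\<^esub>"
    using yz by (simp add: beta_map_def \<theta>_zero \<theta>'_zero)
  show "a \<otimes>\<^bsub>A\<^esub> b \<in> beta_dom D (ginv (coarse Y) u)"
    if "v \<in> Mor (coarse Y)" "Src (coarse Y) u = Tgt (coarse Y) v"
      "a \<in> beta_dom D (ginv (coarse Y) u)" "b \<in> beta_dom D v" for a b
  proof -
    have "snd v = y" using that(1,2) yz(1) by (auto simp: coarse_def)
    then show ?thesis using yz that(3,4) by (simp add: beta_dom_def ginv_coarse D_Obj_mult)
  qed
  show "\<zero>\<^bsub>A\<^esub> \<otimes>\<^bsub>A\<^esub> b = \<zero>\<^bsub>A\<^esub>" "b \<otimes>\<^bsub>A\<^esub> \<zero>\<^bsub>A\<^esub> = \<zero>\<^bsub>A\<^esub>" if "b \<in> beta_dom D u" for b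
    using yz that D_Obj_carrier by (auto simp: beta_dom_def)
qed

lemma abelian_monoid_C: "abelian_monoid C"
  unfolding coarse_skew_ring_def
  by (rule skew_data.abelian_monoid_skew_ring[OF skew_data_coarse])

lemma C_carrier_iff:
  "f \<in> carrier C \<longleftrightarrow> (\<forall>y\<in>Y. \<forall>z\<in>Y. f (y, z) \<in> D z) \<and> (\<forall>u. u \<notin> Y \<times> Y \<longrightarrow> f u = \<zero>\<^bsub>A\<^esub>)"
proof -
  have "finite {u. f u \<noteq> \<zero>\<^bsub>A\<^esub>}" if "\<forall>u. u \<notin> Y \<times> Y \<longrightarrow> f u = \<zero>\<^bsub>A\<^esub>"
    by (rule finite_subset[of _ "Y \<times> Y"]) (use that finite_Obj in auto)
  moreover have "(\<forall>u\<in>Y \<times> Y. f u \<in> beta_dom D u) \<longleftrightarrow> (\<forall>y\<in>Y. \<forall>z\<in>Y. f (y, z) \<in> D z)"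
    by (auto simp: beta_dom_def)
  ultimately show ?thesis
    unfolding coarse_skew_ring_def skew_data.skew_ring_carrier_iff[OF skew_data_coarse]
    by (auto simp: coarse_def)
qed

lemma C_D: "\<lbrakk>f \<in> carrier C; y \<in> Y; z \<in> Y\<rbrakk> \<Longrightarrow> f (y, z) \<in> D z"
  and C_out: "\<lbrakk>f \<in> carrier C; u \<notin> Y \<times> Y\<rbrakk> \<Longrightarrow> f u = \<zero>\<^bsub>A\<^esub>"
  unfolding C_carrier_iff by blast+

lemma C_in_A: "f \<in> carrier C \<Longrightarrow> f u \<in> carrier A"
  using C_D[of f "fst u" "snd u"] C_out[of f u] D_Obj_carrier
  by (cases "u \<in> Y \<times> Y") auto

lemma C_add_apply: "(f \<oplus>\<^bsub>C\<^esub> f') u = f u \<oplus>\<^bsub>A\<^esub> f' u"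
  and C_zero_apply: "\<zero>\<^bsub>C\<^esub> u = \<zero>\<^bsub>A\<^esub>"
  by (simp_all add: coarse_skew_ring_def skew_ring_def)

text \<open>A pair \<open>(w, z)\<close> factors in the coarse groupoid exactly as \<open>(y, z)(w, y)\<close>, once for each object
  \<open>y\<close>, so the product is a matrix product.\<close>

lemma C_mult_apply:
  assumes f: "f \<in> carrier C" and f': "f' \<in> carrier C" and wz: "w \<in> Y" "z \<in> Y"
  shows "(f \<otimes>\<^bsub>C\<^esub> f') (w, z) = (\<Oplus>\<^bsub>A\<^esub>y\<in>Y. f (y, z) \<otimes>\<^bsub>A\<^esub> \<theta> z (\<theta>' y (f' (w, y))))"
proof -
  interpret co: skew_data A "coarse Y" "beta_dom D" "beta_map Gr \<alpha> h" by (rule skew_data_coarse)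
  let ?t = "\<lambda>(u, v). co.monomial_mult u (f u) (f' v)"
  let ?p = "\<lambda>y. ((y, z), (w, y))"
  have sum_p: "(f \<otimes>\<^bsub>C\<^esub> f') (w, z) = finsum A ?t (?p ` Y)"
    unfolding coarse_skew_ring_def
  proof (rule co.skew_mult_eq)
    show "?p ` Y \<subseteq> co.factorizations (w, z)"
      unfolding co.factorizations_def using wz by (auto simp: coarse_def)
    show "(u, v) \<in> ?p ` Y" if "(u, v) \<in> co.factorizations (w, z)" for u v
      using that unfolding co.factorizations_def by (auto simp: coarse_def)
  qed (use f f' finite_Obj in \<open>simp_all add: coarse_skew_ring_def\<close>)
  have t: "?t (?p y) = f (y, z) \<otimes>\<^bsub>A\<^esub> \<theta> z (\<theta>' y (f' (w, y)))" if y: "y \<in> Y" for y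
  proof -
    have 1: "\<theta>' z (f (y, z)) \<in> D x" "\<theta>' y (f' (w, y)) \<in> D x"
      using C_D[OF f y wz(2)] C_D[OF f' wz(1) y] y wz by (simp_all add: \<theta>'_in)
    have 2: "\<theta> y (\<theta>' z (f (y, z))) \<in> D y" "f' (w, y) \<in> D y"
      using 1 C_D[OF f' wz(1) y] y by (simp_all add: \<theta>_in)
    show ?thesis
      using 1 2 C_D[OF f y wz(2)] y wz
      by (simp add: ginv_coarse beta_map_def \<theta>'_mult \<theta>'_\<theta> \<theta>_mult \<theta>_\<theta>')
  qed
  have in_A: "f (y, z) \<otimes>\<^bsub>A\<^esub> \<theta> z (\<theta>' y (f' (w, y))) \<in> carrier A" if y: "y \<in> Y" for y
  proof (rule D_Obj_carrier[OF wz(2)], rule D_Obj_mult[OF wz(2) C_D[OF f y wz(2)]])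
    show "\<theta> z (\<theta>' y (f' (w, y))) \<in> D z"
      using C_D[OF f' wz(1) y] y wz by (intro \<theta>_in \<theta>'_in) simp_all
  qed
  note sum_p
  also have "finsum A ?t (?p ` Y) = finsum A (\<lambda>y. ?t (?p y)) Y"
  proof (rule finsum_reindex)
    show "?t \<in> ?p ` Y \<rightarrow> carrier A"
    proof
      fix i assume "i \<in> ?p ` Y"
      then obtain y where y: "y \<in> Y" and i: "i = ?p y" by blast
      show "?t i \<in> carrier A" unfolding i t[OF y] by (rule in_A[OF y])
    qed
    show "inj_on ?p Y" by (simp add: inj_on_def)
  qed
  also have "\<dots> = (\<Oplus>\<^bsub>A\<^esub>y\<in>Y. f (y, z) \<otimes>\<^bsub>A\<^esub> \<theta> z (\<theta>' y (f' (w, y))))"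
    by (rule finsum_cong'[OF refl]) (use in_A in blast, rule t)
  finally show ?thesis .
qed


lemma C_mult_outside:
  assumes "f \<in> carrier C" "f' \<in> carrier C" "u \<notin> Y \<times> Y"
  shows "(f \<otimes>\<^bsub>C\<^esub> f') u = \<zero>\<^bsub>A\<^esub>"
  using assms skew_data.skew_mult_outside[OF skew_data_coarse, of f f' u]
  by (simp add: coarse_skew_ring_def coarse_def)

lemma C_mult_term:
  assumes f: "f \<in> carrier C" and f': "f' \<in> carrier C" and wyz: "w \<in> Y" "y \<in> Y" "z \<in> Y"
  shows "f (y, z) \<otimes>\<^bsub>A\<^esub> \<theta> z (\<theta>' y (f' (w, y))) \<in> D z"
    and "\<theta>' z (f (y, z) \<otimes>\<^bsub>A\<^esub> \<theta> z (\<theta>' y (f' (w, y)))) = \<theta>' z (f (y, z)) \<otimes>\<^bsub>A\<^esub> \<theta>' y (f' (w, y))"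
proof -
  have 1: "\<theta>' y (f' (w, y)) \<in> D x" using C_D[OF f' wyz(1,2)] wyz by (simp add: \<theta>'_in)
  then have 2: "\<theta> z (\<theta>' y (f' (w, y))) \<in> D z" using wyz by (simp add: \<theta>_in)
  show "f (y, z) \<otimes>\<^bsub>A\<^esub> \<theta> z (\<theta>' y (f' (w, y))) \<in> D z"
    by (rule D_Obj_mult[OF wyz(3) C_D[OF f wyz(2,3)] 2])
  show "\<theta>' z (f (y, z) \<otimes>\<^bsub>A\<^esub> \<theta> z (\<theta>' y (f' (w, y)))) = \<theta>' z (f (y, z)) \<otimes>\<^bsub>A\<^esub> \<theta>' y (f' (w, y))"
    using \<theta>'_mult[OF wyz(3) C_D[OF f wyz(2,3)] 2] \<theta>'_\<theta>[OF wyz(3) 1] by simp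
qed

text \<open>In the coordinates \<open>\<theta>\<^sub>z\<^sup>-\<^sup>1(f(w, z))\<close> the twists disappear: the coarse skew ring is the ring of
  matrices over \<open>A\<^sub>x\<close> with rows and columns indexed by the objects.\<close>

lemma C_mult_coordinates:
  assumes f: "f \<in> carrier C" and f': "f' \<in> carrier C" and wz: "w \<in> Y" "z \<in> Y"
  shows "(f \<otimes>\<^bsub>C\<^esub> f') (w, z) \<in> D z \<and> \<theta>' z ((f \<otimes>\<^bsub>C\<^esub> f') (w, z))
      = (\<Oplus>\<^bsub>A\<^esub>y\<in>Y. \<theta>' z (f (y, z)) \<otimes>\<^bsub>A\<^esub> \<theta>' y (f' (w, y)))"
proof -
  let ?t = "\<lambda>y. f (y, z) \<otimes>\<^bsub>A\<^esub> \<theta> z (\<theta>' y (f' (w, y)))"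
  have z: "z \<in> Mor Gr" by (rule Obj_Mor[OF wz(2)])
  have "finsum A ?t Y \<in> D z \<and> \<theta>' z (finsum A ?t Y) = finsum A (\<lambda>y. \<theta>' z (?t y)) Y"
  proof (rule finsum_additive_on[OF abelian_monoid_axioms abelian_monoid_axioms])
    show "D z \<subseteq> carrier A" "\<zero>\<^bsub>A\<^esub> \<in> D z" by (rule D_carrier[OF z], rule D_zero[OF z])
    show "\<theta>' z a \<in> carrier A" if "a \<in> D z" for a
      by (rule D_Obj_carrier[OF x_Obj \<theta>'_in[OF wz(2) that]])
    show "?t y \<in> D z" if "y \<in> Y" for y
      by (rule C_mult_term(1)[OF f f' wz(1) that wz(2)])
  qed (use D_add[OF z] \<theta>'_zero[OF wz(2)] \<theta>'_add[OF wz(2)] finite_Obj in blast)+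
  moreover have "finsum A (\<lambda>y. \<theta>' z (?t y)) Y
      = (\<Oplus>\<^bsub>A\<^esub>y\<in>Y. \<theta>' z (f (y, z)) \<otimes>\<^bsub>A\<^esub> \<theta>' y (f' (w, y)))"
  proof (rule finsum_cong'[OF refl])
    show "(\<lambda>y. \<theta>' z (f (y, z)) \<otimes>\<^bsub>A\<^esub> \<theta>' y (f' (w, y))) \<in> Y \<rightarrow> carrier A"
    proof
      fix y assume y: "y \<in> Y"
      have "\<theta>' z (f (y, z)) \<in> D x" "\<theta>' y (f' (w, y)) \<in> D x"
        using C_D[OF f y wz(2)] C_D[OF f' wz(1) y] y wz by (simp_all add: \<theta>'_in)
      then show "\<theta>' z (f (y, z)) \<otimes>\<^bsub>A\<^esub> \<theta>' y (f' (w, y)) \<in> carrier A"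
        using D_Obj_carrier[OF x_Obj] by simp
    qed
  qed (rule C_mult_term(2)[OF f f' wz(1) _ wz(2)])
  ultimately show ?thesis using C_mult_apply[OF f f' wz] by simp
qed

lemma C_mult_closed:
  assumes "f \<in> carrier C" "f' \<in> carrier C"
  shows "f \<otimes>\<^bsub>C\<^esub> f' \<in> carrier C"
  unfolding C_carrier_iff
  using C_mult_coordinates[OF assms] C_mult_outside[OF assms] by blast

lemma identity_of_D: "y \<in> Y \<Longrightarrow> is_identity_of A (D y) (identity_of A (D y))"
  using unital_D[of y] identity_of_eqI unfolding unital_def by metis

text \<open>The isomorphism \<open>\<theta>\<^sub>y\<^sup>-\<^sup>1\<close> is onto \<open>A\<^sub>x\<close>, so it carries an identity element to one.\<close>

lemma \<theta>'_identity:
  assumes y: "y \<in> Y"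
  shows "is_identity_of A (D x) (\<theta>' y (identity_of A (D y)))"
proof -
  let ?e = "identity_of A (D y)"
  have e: "?e \<in> D y" "\<And>a. a \<in> D y \<Longrightarrow> ?e \<otimes>\<^bsub>A\<^esub> a = a" "\<And>a. a \<in> D y \<Longrightarrow> a \<otimes>\<^bsub>A\<^esub> ?e = a"
    using identity_of_D[OF y] by (simp_all add: is_identity_of_def)
  show ?thesis
    unfolding is_identity_of_def
  proof (intro conjI ballI)
    show "\<theta>' y ?e \<in> D x" using y e(1) by (rule \<theta>'_in)
    fix a assume a: "a \<in> D x"
    note ya = \<theta>_in[OF y a]
    show "\<theta>' y ?e \<otimes>\<^bsub>A\<^esub> a = a" "a \<otimes>\<^bsub>A\<^esub> \<theta>' y ?e = a"
      using \<theta>'_mult[OF y e(1) ya] \<theta>'_mult[OF y ya e(1)] \<theta>'_\<theta>[OF y a] e(2,3)[OF ya] by simp_all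
  qed
qed

text \<open>The identity matrix. The identity element of the skew ring over \<open>C\<close> refers to the identity of the
  ideal of \<open>C\<close> at the object \<open>x\<close>, which is all of \<open>C\<close>; this is its value.\<close>

definition C_one :: "'g \<times> 'g \<Rightarrow> 'a" where
  "C_one u = (if u \<in> Y \<times> Y \<and> fst u = snd u then identity_of A (D (snd u)) else \<zero>\<^bsub>A\<^esub>)"

lemma C_eqI:
  assumes "f \<in> carrier C" "f' \<in> carrier C"
    and "\<And>w z. \<lbrakk>w \<in> Y; z \<in> Y\<rbrakk> \<Longrightarrow> \<theta>' z (f (w, z)) = \<theta>' z (f' (w, z))"
  shows "f = f'"
proof
  fix u
  show "f u = f' u"
  proof (cases "u \<in> Y \<times> Y")
    case True
    then obtain w z where u: "u = (w, z)" "w \<in> Y" "z \<in> Y" by blast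
    have "f (w, z) = \<theta> z (\<theta>' z (f (w, z)))" using \<theta>_\<theta>' C_D[OF assms(1)] u by simp
    also have "\<dots> = f' (w, z)" using assms(3) \<theta>_\<theta>' C_D[OF assms(2)] u by simp
    finally show ?thesis by (simp add: u)
  qed (simp add: C_out assms(1,2))
qed

lemma is_identity_C_one: "is_identity_of C (carrier C) C_one"
  unfolding is_identity_of_def
proof (intro conjI ballI)
  show one: "C_one \<in> carrier C"
    using identity_of_D D_zero[OF Obj_Mor] by (auto simp: C_carrier_iff C_one_def is_identity_of_def)
  fix f assume f: "f \<in> carrier C"
  have coord: "\<theta>' z (f (w, z)) \<in> D x" if "w \<in> Y" "z \<in> Y" for w z
    using C_D[OF f that] that by (simp add: \<theta>'_in)
  have coordA: "\<theta>' z (f (w, z)) \<in> carrier A" if "w \<in> Y" "z \<in> Y" for w z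
    by (rule D_Obj_carrier[OF x_Obj coord[OF that]])
  have unit: "\<theta>' y (C_one (y, y)) \<otimes>\<^bsub>A\<^esub> a = a" "a \<otimes>\<^bsub>A\<^esub> \<theta>' y (C_one (y, y)) = a"
    if "y \<in> Y" "a \<in> D x" for y a
    using \<theta>'_identity[OF that(1)] that by (simp_all add: is_identity_of_def C_one_def)
  have off: "\<theta>' z (C_one (y, z)) = \<zero>\<^bsub>A\<^esub>" if "z \<in> Y" "y \<noteq> z" for y z
    using that by (simp add: C_one_def \<theta>'_zero)
  show "C_one \<otimes>\<^bsub>C\<^esub> f = f"
  proof (rule C_eqI[OF C_mult_closed[OF one f] f])
    fix w z assume wz: "w \<in> Y" "z \<in> Y"
    have "(\<Oplus>\<^bsub>A\<^esub>y\<in>Y. \<theta>' z (C_one (y, z)) \<otimes>\<^bsub>A\<^esub> \<theta>' y (f (w, y)))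
        = \<theta>' z (C_one (z, z)) \<otimes>\<^bsub>A\<^esub> \<theta>' z (f (w, z))"
      using wz by (intro finsum_single) (simp_all add: finite_Obj unit coord coordA off)
    then show "\<theta>' z ((C_one \<otimes>\<^bsub>C\<^esub> f) (w, z)) = \<theta>' z (f (w, z))"
      using C_mult_coordinates[OF one f wz] unit coord wz by simp
  qed
  show "f \<otimes>\<^bsub>C\<^esub> C_one = f"
  proof (rule C_eqI[OF C_mult_closed[OF f one] f])
    fix w z assume wz: "w \<in> Y" "z \<in> Y"
    have "(\<Oplus>\<^bsub>A\<^esub>y\<in>Y. \<theta>' z (f (y, z)) \<otimes>\<^bsub>A\<^esub> \<theta>' y (C_one (w, y)))
        = \<theta>' z (f (w, z)) \<otimes>\<^bsub>A\<^esub> \<theta>' w (C_one (w, w))"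
      using wz by (intro finsum_single) (simp_all add: finite_Obj unit coord coordA off)
    then show "\<theta>' z ((f \<otimes>\<^bsub>C\<^esub> C_one) (w, z)) = \<theta>' z (f (w, z))"
      using C_mult_coordinates[OF f one wz] unit coord wz by simp
  qed
qed

section \<open>The action of the isotropy group on the coarse skew groupoid ring\<close>

abbreviation "E \<equiv> eps_dom A Gr D \<alpha> h"
abbreviation "\<epsilon> \<equiv> eps_map A Gr D \<alpha> h"

lemma E_iff:
  assumes "k \<in> G"
  shows "f \<in> E k \<longleftrightarrow> f \<in> carrier C \<and> (\<forall>y\<in>Y. \<forall>z\<in>Y. \<theta>' z (f (y, z)) \<in> D k)"
  using assms image_\<theta>_iff[OF assms] C_D[of f] by (auto simp: eps_dom_def)

lemma E_carrier: "f \<in> E k \<Longrightarrow> f \<in> carrier C"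
  by (simp add: eps_dom_def)

lemma E_coordinates: "\<lbrakk>k \<in> G; f \<in> E k; y \<in> Y; z \<in> Y\<rbrakk> \<Longrightarrow> \<theta>' z (f (y, z)) \<in> D k"
  by (simp add: E_iff)

lemma E_x: "E x = carrier C"
  using C_D by (auto simp: E_iff x_loop \<theta>'_in)

lemma \<epsilon>_apply:
  assumes k: "k \<in> G" and f: "f \<in> E (ginv Gr k)" and yz: "y \<in> Y" "z \<in> Y"
  shows "\<epsilon> k f (y, z) = \<theta> z (\<alpha> k (\<theta>' z (f (y, z))))"
    and "\<epsilon> k f (y, z) \<in> D z"
    and "\<theta>' z (\<epsilon> k f (y, z)) = \<alpha> k (\<theta>' z (f (y, z)))"
proof -
  let ?c = "\<theta>' z (f (y, z))"
  have c: "?c \<in> D (ginv Gr k)" by (rule E_coordinates[OF ginv_loop[OF k] f yz])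
  have "inj_on (\<theta> z) (D (ginv Gr k))"
    using \<theta>'_\<theta>[OF yz(2)] D_loop[OF ginv_loop[OF k]] by (intro inj_on_inverseI[of _ "\<theta>' z"]) blast
  then have "inv_into (D (ginv Gr k)) (\<theta> z) (f (y, z)) = ?c"
    using c by (rule inv_into_f_eq) (rule \<theta>_\<theta>'[OF yz(2) C_D[OF E_carrier[OF f] yz]])
  then show 1: "\<epsilon> k f (y, z) = \<theta> z (\<alpha> k ?c)" using yz by (simp add: eps_map_def)
  have "\<alpha> k ?c \<in> D x" using action_in[OF loop_Mor[OF k] c] D_loop[OF k] by blast
  then show "\<epsilon> k f (y, z) \<in> D z" "\<theta>' z (\<epsilon> k f (y, z)) = \<alpha> k ?c"
    unfolding 1 using yz by (simp_all add: \<theta>_in \<theta>'_\<theta>)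
qed

lemma \<epsilon>_in:
  assumes k: "k \<in> G" and f: "f \<in> E (ginv Gr k)"
  shows "\<epsilon> k f \<in> E k"
proof -
  have "\<epsilon> k f \<in> carrier C"
    unfolding C_carrier_iff using \<epsilon>_apply(2)[OF k f] by (simp add: eps_map_def)
  moreover have "\<theta>' z (\<epsilon> k f (y, z)) \<in> D k" if yz: "y \<in> Y" "z \<in> Y" for y z
    unfolding \<epsilon>_apply(3)[OF k f yz]
    by (rule action_in[OF loop_Mor[OF k] E_coordinates[OF ginv_loop[OF k] f yz]])
  ultimately show ?thesis by (simp add: E_iff k)
qed

lemma E_mult_coordinates:
  assumes k: "k \<in> G" and f: "f \<in> E k" and f': "f' \<in> carrier C"
    and wyz: "w \<in> Y" "y \<in> Y" "z \<in> Y"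
  shows "\<theta>' z (f (y, z)) \<otimes>\<^bsub>A\<^esub> \<theta>' y (f' (w, y)) \<in> D k"
proof (rule D_mult_right[OF loop_Mor[OF k]])
  show "\<theta>' z (f (y, z)) \<in> D k" by (rule E_coordinates[OF k f wyz(2,3)])
  show "\<theta>' y (f' (w, y)) \<in> D (Tgt Gr k)"
    using C_D[OF f' wyz(1,2)] wyz by (simp add: Tgt_loop[OF k] \<theta>'_in)
qed

text \<open>In coordinates \<open>E k\<close> consists of the matrices with entries in the ideal \<open>A\<^sub>k\<close> of \<open>A\<^sub>x\<close>.\<close>

lemma E_ideal_right:
  assumes k: "k \<in> G" and f: "f \<in> E k" and f': "f' \<in> carrier C"
  shows "f \<otimes>\<^bsub>C\<^esub> f' \<in> E k"
proof -
  note kM = loop_Mor[OF k]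
  have "\<theta>' z ((f \<otimes>\<^bsub>C\<^esub> f') (w, z)) \<in> D k" if wz: "w \<in> Y" "z \<in> Y" for w z
  proof -
    let ?t = "\<lambda>y. \<theta>' z (f (y, z)) \<otimes>\<^bsub>A\<^esub> \<theta>' y (f' (w, y))"
    have "finsum A ?t Y \<in> D k \<and> id (finsum A ?t Y) = finsum A (\<lambda>y. id (?t y)) Y"
    proof (rule finsum_additive_on[OF abelian_monoid_axioms abelian_monoid_axioms])
      show "?t y \<in> D k" if "y \<in> Y" for y
        by (rule E_mult_coordinates[OF k f f' wz(1) that wz(2)])
    qed (use D_carrier[OF kM] D_zero[OF kM] D_add[OF kM] finite_Obj in auto)
    then show ?thesis using C_mult_coordinates[OF E_carrier[OF f] f' wz] by simp
  qed
  then show ?thesis using C_mult_closed[OF E_carrier[OF f] f'] by (simp add: E_iff[OF k])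
qed

lemma isotropy_fields:
  "Mor (isotropy Gr x) = G" "Src (isotropy Gr x) = Src Gr" "Tgt (isotropy Gr x) = Tgt Gr"
  "Cmp (isotropy Gr x) = Cmp Gr"
  by (simp_all add: isotropy_def)

lemma ginv_G: "k \<in> G \<Longrightarrow> ginv (isotropy Gr x) k = ginv Gr k"
  by (rule ginv_isotropy[OF x_Obj])

lemma C_zero_mult:
  assumes f: "f \<in> carrier C"
  shows "\<zero>\<^bsub>C\<^esub> \<otimes>\<^bsub>C\<^esub> f = \<zero>\<^bsub>C\<^esub>" "f \<otimes>\<^bsub>C\<^esub> \<zero>\<^bsub>C\<^esub> = \<zero>\<^bsub>C\<^esub>"
proof -
  interpret C: abelian_monoid C by (rule abelian_monoid_C)
  have coordA: "\<theta>' z (f (w, z)) \<in> carrier A" if "w \<in> Y" "z \<in> Y" for w z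
    by (rule D_Obj_carrier[OF x_Obj \<theta>'_in[OF that(2) C_D[OF f that]]])
  have sum0: "finsum A t Y = \<zero>\<^bsub>A\<^esub>" if "\<And>y. y \<in> Y \<Longrightarrow> t y = \<zero>\<^bsub>A\<^esub>" for t
    by (rule add.finprod_one_eqI) (rule that)
  show "\<zero>\<^bsub>C\<^esub> \<otimes>\<^bsub>C\<^esub> f = \<zero>\<^bsub>C\<^esub>"
  proof (rule C_eqI[OF C_mult_closed[OF C.zero_closed f] C.zero_closed])
    fix w z assume wz: "w \<in> Y" "z \<in> Y"
    show "\<theta>' z ((\<zero>\<^bsub>C\<^esub> \<otimes>\<^bsub>C\<^esub> f) (w, z)) = \<theta>' z (\<zero>\<^bsub>C\<^esub> (w, z))"
      unfolding conjunct2[OF C_mult_coordinates[OF C.zero_closed f wz]] C_zero_apply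
      using wz coordA by (subst sum0) (simp_all add: \<theta>'_zero)
  qed
  show "f \<otimes>\<^bsub>C\<^esub> \<zero>\<^bsub>C\<^esub> = \<zero>\<^bsub>C\<^esub>"
  proof (rule C_eqI[OF C_mult_closed[OF f C.zero_closed] C.zero_closed])
    fix w z assume wz: "w \<in> Y" "z \<in> Y"
    show "\<theta>' z ((f \<otimes>\<^bsub>C\<^esub> \<zero>\<^bsub>C\<^esub>) (w, z)) = \<theta>' z (\<zero>\<^bsub>C\<^esub> (w, z))"
      unfolding conjunct2[OF C_mult_coordinates[OF f C.zero_closed wz]] C_zero_apply
      using wz coordA by (subst sum0) (simp_all add: \<theta>'_zero)
  qed
qed

lemma skew_data_eps: "skew_data C (isotropy Gr x) E \<epsilon>"
proof (intro skew_data.intro groupoid_isotropy[OF groupoid_axioms x_Obj] abelian_monoid_C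
    skew_data_axioms.intro, unfold isotropy_fields)
  interpret C: abelian_monoid C by (rule abelian_monoid_C)
  fix k assume k: "k \<in> G"
  note kM = loop_Mor[OF k]
  show "E k \<subseteq> carrier C" using E_carrier by blast
  show "\<zero>\<^bsub>C\<^esub> \<in> E k" using D_zero[OF kM] by (simp add: E_iff k C_zero_apply \<theta>'_zero)
  show "a \<oplus>\<^bsub>C\<^esub> b \<in> E k" if a: "a \<in> E k" and b: "b \<in> E k" for a b
    using C.a_closed[OF E_carrier[OF a] E_carrier[OF b]] D_add[OF kM] a b
      C_D[OF E_carrier[OF a]] C_D[OF E_carrier[OF b]]
    by (simp add: E_iff k C_add_apply \<theta>'_add)
  show "\<epsilon> k a \<in> E k" if "a \<in> E (ginv (isotropy Gr x) k)" for a
    using that \<epsilon>_in[OF k] by (simp add: ginv_G k)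
  show "\<epsilon> k \<zero>\<^bsub>C\<^esub> = \<zero>\<^bsub>C\<^esub>"
  proof
    fix u
    have zE: "\<zero>\<^bsub>C\<^esub> \<in> E (ginv Gr k)"
      using D_zero[of "ginv Gr k"] kM by (simp add: E_iff ginv_loop k C_zero_apply \<theta>'_zero)
    show "\<epsilon> k \<zero>\<^bsub>C\<^esub> u = \<zero>\<^bsub>C\<^esub> u"
      using \<epsilon>_apply(1)[OF k zE, of "fst u" "snd u"] kM
      by (cases "u \<in> Y \<times> Y") (auto simp: C_zero_apply \<theta>_zero \<theta>'_zero action_zero eps_map_def)
  qed
  show "a \<otimes>\<^bsub>C\<^esub> b \<in> E (ginv (isotropy Gr x) k)"
    if "a \<in> E (ginv (isotropy Gr x) k)" "b \<in> E l" for a b l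
    using that E_ideal_right[OF ginv_loop[OF k]] E_carrier by (simp add: ginv_G k)
  show "\<zero>\<^bsub>C\<^esub> \<otimes>\<^bsub>C\<^esub> b = \<zero>\<^bsub>C\<^esub>" "b \<otimes>\<^bsub>C\<^esub> \<zero>\<^bsub>C\<^esub> = \<zero>\<^bsub>C\<^esub>" if "b \<in> E k" for b
    using C_zero_mult[OF E_carrier[OF that]] by simp_all
qed

text \<open>A product of monomials in the iterated skew ring, evaluated at a pair of objects, is a sum of
  products of monomials of \<open>A * Gr\<close>, one for each intermediate object. All sums are formed in the
  coordinates over \<open>A\<^sub>x\<close>, where the action of \<open>k\<close> is additive on the ideal \<open>A\<^bsub>k\<^sup>-\<^sup>1\<^esub>\<close> that contains
  every term.\<close>

lemma eps_monomial_mult: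
  assumes k: "k \<in> G" and a: "a \<in> E k" and b: "b \<in> carrier C" and wz: "w \<in> Y" "z \<in> Y"
  shows "\<epsilon> k (\<epsilon> (ginv Gr k) a \<otimes>\<^bsub>C\<^esub> b) (w, z)
    = (\<Oplus>\<^bsub>A\<^esub>y\<in>Y. \<alpha> (arrow y z k) (\<alpha> (ginv Gr (arrow y z k)) (a (y, z)) \<otimes>\<^bsub>A\<^esub> b (w, y)))"
proof -
  note kM = loop_Mor[OF k] and k' = ginv_loop[OF k]
  note k'M = loop_Mor[OF k']
  let ?a = "\<epsilon> (ginv Gr k) a"
  let ?t = "\<lambda>y. \<theta>' z (?a (y, z)) \<otimes>\<^bsub>A\<^esub> \<theta>' y (b (w, y))"
  let ?\<phi> = "\<lambda>c. \<theta> z (\<alpha> k c)"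
  have aE: "a \<in> E (ginv Gr (ginv Gr k))" using a kM by simp
  have a': "?a \<in> E (ginv Gr k)" by (rule \<epsilon>_in[OF k' aE])
  have \<phi>_in: "\<alpha> k c \<in> D x" if "c \<in> D (ginv Gr k)" for c
    using action_in[OF kM that] D_loop[OF k] by blast
  have t: "?\<phi> (?t y)
      = \<alpha> (arrow y z k) (\<alpha> (ginv Gr (arrow y z k)) (a (y, z)) \<otimes>\<^bsub>A\<^esub> b (w, y))"
    if y: "y \<in> Y" for y
  proof -
    have 1: "\<theta>' z (a (y, z)) \<in> D k" by (rule E_coordinates[OF k a y wz(2)])
    have 2: "\<theta>' y (b (w, y)) \<in> D x" by (rule \<theta>'_in[OF y C_D[OF b wz(1) y]])
    show ?thesis
      using monomial_mult_arrow[OF y wz(2) k 1 2] \<epsilon>_apply(3)[OF k' aE y wz(2)]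
        \<theta>_\<theta>'[OF wz(2) C_D[OF E_carrier[OF a] y wz(2)]] \<theta>_\<theta>'[OF y C_D[OF b wz(1) y]]
      by simp
  qed
  have "\<epsilon> k (?a \<otimes>\<^bsub>C\<^esub> b) (w, z) = ?\<phi> (finsum A ?t Y)"
    using \<epsilon>_apply(1)[OF k E_ideal_right[OF k' a' b] wz]
      C_mult_coordinates[OF E_carrier[OF a'] b wz] by simp
  also have "\<dots> = finsum A (\<lambda>y. ?\<phi> (?t y)) Y"
  proof (rule conjunct2[OF finsum_additive_on[OF abelian_monoid_axioms abelian_monoid_axioms,
        where H = "D (ginv Gr k)"]])
    show "?t y \<in> D (ginv Gr k)" if "y \<in> Y" for y
      by (rule E_mult_coordinates[OF k' a' b wz(1) that wz(2)])
    show "?\<phi> c \<in> carrier A" if "c \<in> D (ginv Gr k)" for c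
      by (rule D_Obj_carrier[OF wz(2) \<theta>_in[OF wz(2) \<phi>_in[OF that]]])
    show "?\<phi> (c \<oplus>\<^bsub>A\<^esub> d) = ?\<phi> c \<oplus>\<^bsub>A\<^esub> ?\<phi> d"
      if "c \<in> D (ginv Gr k)" "d \<in> D (ginv Gr k)" for c d
      using that by (simp add: action_add kM \<theta>_add wz(2) \<phi>_in)
    show "?\<phi> \<zero>\<^bsub>A\<^esub> = \<zero>\<^bsub>A\<^esub>" by (simp add: action_zero kM \<theta>_zero wz(2))
  qed (use D_carrier[OF k'M] D_zero[OF k'M] D_add[OF k'M] finite_Obj in simp_all)
  also have "\<dots> = (\<Oplus>\<^bsub>A\<^esub>y\<in>Y.
      \<alpha> (arrow y z k) (\<alpha> (ginv Gr (arrow y z k)) (a (y, z)) \<otimes>\<^bsub>A\<^esub> b (w, y)))"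
  proof (rule finsum_cong'[OF refl])
    show "(\<lambda>y. \<alpha> (arrow y z k) (\<alpha> (ginv Gr (arrow y z k)) (a (y, z)) \<otimes>\<^bsub>A\<^esub> b (w, y)))
        \<in> Y \<rightarrow> carrier A"
    proof
      fix y assume y: "y \<in> Y"
      show "\<alpha> (arrow y z k) (\<alpha> (ginv Gr (arrow y z k)) (a (y, z)) \<otimes>\<^bsub>A\<^esub> b (w, y)) \<in> carrier A"
        unfolding t[OF y, symmetric]
        by (rule D_Obj_carrier[OF wz(2) \<theta>_in[OF wz(2) \<phi>_in[OF
              E_mult_coordinates[OF k' a' b wz(1) y wz(2)]]]])
    qed
  qed (rule t)
  finally show ?thesis .
qed


section \<open>Regrouping formal sums by their loops\<close>

lemma skew_data_A: "skew_data A Gr D \<alpha>"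
proof (intro skew_data.intro groupoid_axioms abelian_monoid_axioms skew_data_axioms.intro)
  fix g assume g: "g \<in> Mor Gr"
  show "D g \<subseteq> carrier A" "\<zero>\<^bsub>A\<^esub> \<in> D g" "\<alpha> g \<zero>\<^bsub>A\<^esub> = \<zero>\<^bsub>A\<^esub>"
    by (rule D_carrier[OF g], rule D_zero[OF g], rule action_zero[OF g])
  show "a \<oplus>\<^bsub>A\<^esub> b \<in> D g" if "a \<in> D g" "b \<in> D g" for a b
    by (rule D_add[OF g that])
  show "\<alpha> g a \<in> D g" if "a \<in> D (ginv Gr g)" for a
    by (rule action_in[OF g that])
  show "a \<otimes>\<^bsub>A\<^esub> b \<in> D (ginv Gr g)"
    if "k \<in> Mor Gr" "Src Gr g = Tgt Gr k" "a \<in> D (ginv Gr g)" "b \<in> D k" for k a b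
    using that g D_subset_Tgt[of k] by (intro D_mult_right) auto
  show "\<zero>\<^bsub>A\<^esub> \<otimes>\<^bsub>A\<^esub> b = \<zero>\<^bsub>A\<^esub>" "b \<otimes>\<^bsub>A\<^esub> \<zero>\<^bsub>A\<^esub> = \<zero>\<^bsub>A\<^esub>" if "b \<in> D g" for b
    using that D_carrier[OF g] by auto
qed

abbreviation "AG \<equiv> skew_ring A Gr D \<alpha>"
abbreviation "CG \<equiv> skew_ring C (isotropy Gr x) E \<epsilon>"

lemma AG_carrier_iff:
  "f \<in> carrier AG \<longleftrightarrow> (\<forall>g\<in>Mor Gr. f g \<in> D g) \<and> (\<forall>g. g \<notin> Mor Gr \<longrightarrow> f g = \<zero>\<^bsub>A\<^esub>)
     \<and> finite {g. f g \<noteq> \<zero>\<^bsub>A\<^esub>}"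
  by (rule skew_data.skew_ring_carrier_iff[OF skew_data_A])

lemma CG_carrier_iff:
  "F \<in> carrier CG \<longleftrightarrow> (\<forall>k\<in>G. F k \<in> E k) \<and> (\<forall>k. k \<notin> G \<longrightarrow> F k = \<zero>\<^bsub>C\<^esub>)
     \<and> finite {k. F k \<noteq> \<zero>\<^bsub>C\<^esub>}"
  using skew_data.skew_ring_carrier_iff[OF skew_data_eps, of F] by (simp add: isotropy_fields)

text \<open>The map \<open>a \<delta>\<^sub>g \<mapsto> (a \<delta>\<^bsub>(y, z)\<^esub>) \<delta>\<^sub>k\<close> for \<open>g = h\<^sub>z k h\<^sub>y\<^sup>-\<^sup>1\<close>, in terms of coefficient functions, and its
  inverse.\<close>

definition regroup :: "('g \<Rightarrow> 'a) \<Rightarrow> 'g \<Rightarrow> 'g \<times> 'g \<Rightarrow> 'a" where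
  "regroup f k u = (if k \<in> G \<and> u \<in> Y \<times> Y then f (arrow (fst u) (snd u) k) else \<zero>\<^bsub>A\<^esub>)"

definition ungroup :: "('g \<Rightarrow> 'g \<times> 'g \<Rightarrow> 'a) \<Rightarrow> 'g \<Rightarrow> 'a" where
  "ungroup F g = (if g \<in> Mor Gr then F (loop_of g) (Src Gr g, Tgt Gr g) else \<zero>\<^bsub>A\<^esub>)"

lemma regroup_apply: "\<lbrakk>k \<in> G; y \<in> Y; z \<in> Y\<rbrakk> \<Longrightarrow> regroup f k (y, z) = f (arrow y z k)"
  by (simp add: regroup_def)

lemma regroup_outside: "\<not> (k \<in> G \<and> u \<in> Y \<times> Y) \<Longrightarrow> regroup f k u = \<zero>\<^bsub>A\<^esub>"
  unfolding regroup_def by (rule if_not_P)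

lemma C_zero_eq: "\<zero>\<^bsub>C\<^esub> = (\<lambda>u. \<zero>\<^bsub>A\<^esub>)"
  by (rule ext) (rule C_zero_apply)

lemma regroup_in:
  assumes f: "f \<in> carrier AG"
  shows "regroup f \<in> carrier CG"
  unfolding CG_carrier_iff
proof (intro conjI ballI allI impI)
  fix k assume k: "k \<in> G"
  have *: "f (arrow y z k) \<in> D z \<and> \<theta>' z (f (arrow y z k)) \<in> D k" if yz: "y \<in> Y" "z \<in> Y" for y z
  proof -
    have "f (arrow y z k) \<in> D (arrow y z k)"
      using f arrow_Mor[OF yz k] by (simp add: AG_carrier_iff)
    then show ?thesis unfolding D_arrow[OF yz k] image_\<theta>_iff[OF k yz(2)] .
  qed
  show "regroup f k \<in> E k"
    unfolding E_iff[OF k] C_carrier_iff using * by (simp add: regroup_def k)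
next
  fix k assume "k \<notin> G"
  then show "regroup f k = \<zero>\<^bsub>C\<^esub>" by (simp add: C_zero_eq regroup_def fun_eq_iff)
next
  show "finite {k. regroup f k \<noteq> \<zero>\<^bsub>C\<^esub>}"
  proof (rule finite_subset)
    show "{k. regroup f k \<noteq> \<zero>\<^bsub>C\<^esub>} \<subseteq> loop_of ` {g. f g \<noteq> \<zero>\<^bsub>A\<^esub>}"
    proof
      fix k assume "k \<in> {k. regroup f k \<noteq> \<zero>\<^bsub>C\<^esub>}"
      then obtain u where u: "regroup f k u \<noteq> \<zero>\<^bsub>A\<^esub>" by (auto simp: C_zero_eq fun_eq_iff)
      then have ku: "k \<in> G \<and> u \<in> Y \<times> Y" using regroup_outside by blast
      then obtain y z where yz: "u = (y, z)" "y \<in> Y" "z \<in> Y" by blast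
      have "f (arrow y z k) \<noteq> \<zero>\<^bsub>A\<^esub>" using u ku yz by (simp add: regroup_apply)
      moreover have "k = loop_of (arrow y z k)" using ku yz by (simp add: loop_of_arrow)
      ultimately show "k \<in> loop_of ` {g. f g \<noteq> \<zero>\<^bsub>A\<^esub>}" by blast
    qed
    show "finite (loop_of ` {g. f g \<noteq> \<zero>\<^bsub>A\<^esub>})" using f by (simp add: AG_carrier_iff)
  qed
qed

lemma ungroup_in:
  assumes F: "F \<in> carrier CG"
  shows "ungroup F \<in> carrier AG"
  unfolding AG_carrier_iff
proof (intro conjI ballI allI impI)
  fix g assume g: "g \<in> Mor Gr"
  have o: "Src Gr g \<in> Y" "Tgt Gr g \<in> Y" "loop_of g \<in> G"
    using g by (simp_all add: Src_in_Obj Tgt_in_Obj loop_of_in)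
  have FE: "F (loop_of g) \<in> E (loop_of g)" using F o(3) by (simp add: CG_carrier_iff)
  have "F (loop_of g) (Src Gr g, Tgt Gr g) \<in> \<theta> (Tgt Gr g) ` D (loop_of g)"
    unfolding image_\<theta>_iff[OF o(3,2)]
    using C_D[OF E_carrier[OF FE] o(1,2)] E_coordinates[OF o(3) FE o(1,2)] by simp
  then show "ungroup F g \<in> D g"
    unfolding D_arrow[OF o, symmetric] arrow_loop_of[OF g] by (simp add: ungroup_def g)
next
  fix g assume "g \<notin> Mor Gr"
  then show "ungroup F g = \<zero>\<^bsub>A\<^esub>" by (simp add: ungroup_def)
next
  show "finite {g. ungroup F g \<noteq> \<zero>\<^bsub>A\<^esub>}"
  proof (rule finite_subset)
    show "{g. ungroup F g \<noteq> \<zero>\<^bsub>A\<^esub>}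
        \<subseteq> (\<lambda>(k, u). arrow (fst u) (snd u) k) ` ({k. F k \<noteq> \<zero>\<^bsub>C\<^esub>} \<times> (Y \<times> Y))"
    proof
      fix g assume "g \<in> {g. ungroup F g \<noteq> \<zero>\<^bsub>A\<^esub>}"
      then have g: "g \<in> Mor Gr" "F (loop_of g) (Src Gr g, Tgt Gr g) \<noteq> \<zero>\<^bsub>A\<^esub>"
        by (auto simp: ungroup_def split: if_splits)
      have "F (loop_of g) \<noteq> \<zero>\<^bsub>C\<^esub>" using g(2) C_zero_apply by metis
      then have "(loop_of g, (Src Gr g, Tgt Gr g)) \<in> {k. F k \<noteq> \<zero>\<^bsub>C\<^esub>} \<times> (Y \<times> Y)"
        using g(1) by (simp add: Src_in_Obj Tgt_in_Obj)
      from imageI[OF this, of "\<lambda>(k, u). arrow (fst u) (snd u) k"]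
      show "g \<in> (\<lambda>(k, u). arrow (fst u) (snd u) k) ` ({k. F k \<noteq> \<zero>\<^bsub>C\<^esub>} \<times> (Y \<times> Y))"
        by (simp add: arrow_loop_of[OF g(1)])
    qed
    show "finite ((\<lambda>(k, u). arrow (fst u) (snd u) k) ` ({k. F k \<noteq> \<zero>\<^bsub>C\<^esub>} \<times> (Y \<times> Y)))"
      using F finite_Obj by (simp add: CG_carrier_iff)
  qed
qed

lemma bij_betw_regroup: "bij_betw regroup (carrier AG) (carrier CG)"
proof (rule bij_betw_byWitness[where f' = ungroup])
  show "\<forall>f\<in>carrier AG. ungroup (regroup f) = f"
  proof (intro ballI ext)
    fix f g assume f: "f \<in> carrier AG"
    show "ungroup (regroup f) g = f g"
    proof (cases "g \<in> Mor Gr")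
      case True
      then show ?thesis
        by (simp add: ungroup_def regroup_apply loop_of_in Src_in_Obj Tgt_in_Obj arrow_loop_of)
    next
      case False
      then show ?thesis using f by (simp add: ungroup_def AG_carrier_iff)
    qed
  qed
  show "\<forall>F\<in>carrier CG. regroup (ungroup F) = F"
  proof (intro ballI ext)
    fix F k u assume F: "F \<in> carrier CG"
    show "regroup (ungroup F) k u = F k u"
    proof (cases "k \<in> G \<and> u \<in> Y \<times> Y")
      case True
      then obtain y z where u: "u = (y, z)" "y \<in> Y" "z \<in> Y" by blast
      then show ?thesis
        using True by (simp add: regroup_apply ungroup_def arrow_Mor loop_of_arrow Src_arrow Tgt_arrow)
    next
      case False
      have "F k u = \<zero>\<^bsub>A\<^esub>"
      proof (cases "k \<in> G")
        case True
        then have "F k \<in> E k" using F by (simp add: CG_carrier_iff)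
        then have "F k \<in> carrier C" by (rule E_carrier)
        then show ?thesis using False True by (intro C_out) simp_all
      next
        case False
        then have "F k = \<zero>\<^bsub>C\<^esub>" using F by (simp add: CG_carrier_iff)
        then show ?thesis by (simp add: C_zero_eq)
      qed
      then show ?thesis using regroup_outside[OF False] by simp
    qed
  qed
qed (use regroup_in ungroup_in in blast)+

text \<open>The factorizations of \<open>h\<^sub>z m h\<^sub>w\<^sup>-\<^sup>1\<close> in the groupoid are the pairs
  \<open>(h\<^sub>z k h\<^sub>y\<^sup>-\<^sup>1, h\<^sub>y l h\<^sub>w\<^sup>-\<^sup>1)\<close> with \<open>kl = m\<close> in \<open>G\<close> and an object \<open>y\<close>. Summing first over \<open>y\<close> gives
  the product in the coarse skew ring, and then summing over \<open>(k, l)\<close> the product over \<open>G\<close>.\<close>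

lemma regroup_mult:
  assumes f: "f \<in> carrier AG" and f': "f' \<in> carrier AG"
  shows "regroup (f \<otimes>\<^bsub>AG\<^esub> f') = regroup f \<otimes>\<^bsub>CG\<^esub> regroup f'"
proof (intro ext)
  fix m u
  interpret sx: skew_data A Gr D \<alpha> by (rule skew_data_A)
  interpret sz: skew_data C "isotropy Gr x" E \<epsilon> by (rule skew_data_eps)
  let ?F = "regroup f" and ?F' = "regroup f'"
  have F: "?F \<in> carrier CG" and F': "?F' \<in> carrier CG" by (rule regroup_in[OF f], rule regroup_in[OF f'])
  define Q where "Q = {(k, l). (k, l) \<in> sz.factorizations m \<and> ?F k \<noteq> \<zero>\<^bsub>C\<^esub> \<and> ?F' l \<noteq> \<zero>\<^bsub>C\<^esub>}"
  have fact_iff: "(k, l) \<in> sz.factorizations m \<longleftrightarrow> k \<in> G \<and> l \<in> G \<and> Cmp Gr k l = m" for k l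
    unfolding sz.factorizations_def isotropy_fields using Src_loop Tgt_loop by auto
  have QG: "k \<in> G" "l \<in> G" "Cmp Gr k l = m" if "(k, l) \<in> Q" for k l
    using that by (simp_all add: Q_def fact_iff)
  have finQ: "finite Q"
    by (rule finite_subset[of _ "{k. ?F k \<noteq> \<zero>\<^bsub>C\<^esub>} \<times> {l. ?F' l \<noteq> \<zero>\<^bsub>C\<^esub>}"])
      (use F F' in \<open>auto simp: Q_def CG_carrier_iff\<close>)
  let ?T = "\<lambda>(k, l). sz.monomial_mult k (?F k) (?F' l)"
  have T_eq: "?T (k, l) = \<epsilon> k (\<epsilon> (ginv Gr k) (?F k) \<otimes>\<^bsub>C\<^esub> ?F' l)" if "(k, l) \<in> Q" for k l
    by (simp add: ginv_G[OF QG(1)[OF that]])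
  have FE: "?F k \<in> E k" "?F' k \<in> E k" if "k \<in> G" for k
    using F F' that by (simp_all add: CG_carrier_iff)
  \<comment> \<open>Summation in \<open>C\<close> commutes with evaluation at a pair only if all terms lie in the carrier.\<close>
  have T_in: "?T q \<in> carrier C" if "q \<in> Q" for q
  proof -
    obtain k l where q: "q = (k, l)" by (cases q)
    note kl = QG[OF that[unfolded q]]
    have "sz.monomial_mult k (?F k) (?F' l) \<in> E k"
      by (rule sz.monomial_mult_in[of k l]) (simp_all add: kl FE isotropy_fields loop)
    then show ?thesis using E_carrier q by simp
  qed
  have rhs: "(?F \<otimes>\<^bsub>CG\<^esub> ?F') m = finsum C ?T Q"
    by (rule sz.skew_mult_eq[OF F F' finQ]) (auto simp: Q_def)
  have rhs_C: "(?F \<otimes>\<^bsub>CG\<^esub> ?F') m \<in> carrier C"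
    unfolding rhs using T_in by (intro sz.finsum_closed) blast
  show "regroup (f \<otimes>\<^bsub>AG\<^esub> f') m u = (?F \<otimes>\<^bsub>CG\<^esub> ?F') m u"
  proof (cases "m \<in> G \<and> u \<in> Y \<times> Y")
    case False
    have "(?F \<otimes>\<^bsub>CG\<^esub> ?F') m u = \<zero>\<^bsub>A\<^esub>"
    proof (cases "m \<in> G")
      case True
      then show ?thesis using False rhs_C by (intro C_out) simp_all
    next
      case False
      then show ?thesis using sz.skew_mult_outside[OF F F', of m] by (simp add: isotropy_fields C_zero_eq)
    qed
    then show ?thesis using regroup_outside[OF False] by simp
  next
    case True
    then obtain w z where u: "u = (w, z)" and wz: "w \<in> Y" "z \<in> Y" and m: "m \<in> G" by blast
    let ?t = "\<lambda>(g, g'). sx.monomial_mult g (f g) (f' g')"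
    \<comment> \<open>A factorization over \<open>G\<close> and an intermediate object determine a factorization in \<open>Gr\<close>.\<close>
    let ?p = "\<lambda>((k, l), y). (arrow y z k, arrow w y l)"
    have inj_p: "inj_on ?p (Q \<times> Y)"
    proof (rule inj_onI)
      fix i i' assume i: "i \<in> Q \<times> Y" and i': "i' \<in> Q \<times> Y" and eq: "?p i = ?p i'"
      obtain k l y where iy: "i = ((k, l), y)" by (metis prod.exhaust)
      obtain k' l' y' where iy': "i' = ((k', l'), y')" by (metis prod.exhaust)
      have mem: "(k, l) \<in> Q" "y \<in> Y" "(k', l') \<in> Q" "y' \<in> Y" using i i' iy iy' by auto
      have eqs: "arrow y z k = arrow y' z k'" "arrow w y l = arrow w y' l'" using eq iy iy' by auto
      show "i = i'"
        unfolding iy iy'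
        using arrow_inj[OF eqs(1) mem(2) wz(2) QG(1)[OF mem(1)] mem(4) wz(2) QG(1)[OF mem(3)]]
          arrow_inj[OF eqs(2) wz(1) mem(2) QG(2)[OF mem(1)] wz(1) mem(4) QG(2)[OF mem(3)]]
        by simp
    qed
    have lhs: "(f \<otimes>\<^bsub>AG\<^esub> f') (arrow w z m) = finsum A ?t (?p ` (Q \<times> Y))"
    proof (rule sx.skew_mult_eq[OF f f'])
      show "finite (?p ` (Q \<times> Y))" using finQ finite_Obj by simp
      show "?p ` (Q \<times> Y) \<subseteq> sx.factorizations (arrow w z m)"
      proof
        fix i assume "i \<in> ?p ` (Q \<times> Y)"
        then obtain k l y where i: "i = (arrow y z k, arrow w y l)" and kl: "(k, l) \<in> Q" and y: "y \<in> Y"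
          by auto
        show "i \<in> sx.factorizations (arrow w z m)"
          using QG[OF kl] y wz
          by (simp add: i sx.factorizations_def arrow_Mor Src_arrow Tgt_arrow Cmp_arrow)
      qed
      \<comment> \<open>Every factorization that contributes arises in this way, with \<open>y\<close> the object in the middle.\<close>
      fix g g' assume gg': "(g, g') \<in> sx.factorizations (arrow w z m)"
        and nz: "f g \<noteq> \<zero>\<^bsub>A\<^esub>" "f' g' \<noteq> \<zero>\<^bsub>A\<^esub>"
      have g: "g \<in> Mor Gr" "g' \<in> Mor Gr" "Src Gr g = Tgt Gr g'" "Cmp Gr g g' = arrow w z m"
        using gg' by (simp_all add: sx.factorizations_def)
      have ends: "Tgt Gr g = z" "Src Gr g' = w"
        using g(4) Tgt_Cmp[OF g(1-3)] Src_Cmp[OF g(1-3)] Src_arrow[OF wz m] Tgt_arrow[OF wz m]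
        by simp_all
      let ?k = "loop_of g" and ?l = "loop_of g'" and ?y = "Src Gr g"
      have kl: "?k \<in> G" "?l \<in> G" "?y \<in> Y"
        by (rule loop_of_in[OF g(1)], rule loop_of_in[OF g(2)], rule Src_in_Obj[OF g(1)])
      have garr: "g = arrow ?y z ?k" "g' = arrow w ?y ?l"
        using arrow_loop_of[OF g(1)] arrow_loop_of[OF g(2)] ends g(3) by simp_all
      have "arrow w z (Cmp Gr ?k ?l) = arrow w z m"
        using Cmp_arrow[OF wz(1) kl(3) wz(2) kl(1,2)] g(4) garr by metis
      then have klm: "Cmp Gr ?k ?l = m"
        by (rule arrow_inj(3)[OF _ wz Cmp_loop[OF kl(1,2)] wz m])
      have "?F ?k (?y, z) \<noteq> \<zero>\<^bsub>A\<^esub>" "?F' ?l (w, ?y) \<noteq> \<zero>\<^bsub>A\<^esub>"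
        using nz garr kl wz by (simp_all add: regroup_apply)
      then have "?F ?k \<noteq> \<zero>\<^bsub>C\<^esub>" "?F' ?l \<noteq> \<zero>\<^bsub>C\<^esub>" using C_zero_apply by metis+
      then have "(?k, ?l) \<in> Q" using kl klm by (simp add: Q_def fact_iff)
      then have "((?k, ?l), ?y) \<in> Q \<times> Y" using kl(3) by simp
      from imageI[OF this, of ?p] show "(g, g') \<in> ?p ` (Q \<times> Y)" using garr by simp
    qed
    have t_in: "sx.monomial_mult (arrow y z k) (f (arrow y z k)) (f' (arrow w y l)) \<in> carrier A"
      if kl: "(k, l) \<in> Q" and y: "y \<in> Y" for k l y
    proof -
      have "sx.monomial_mult (arrow y z k) (f (arrow y z k)) (f' (arrow w y l)) \<in> D (arrow y z k)"
        using f f' QG[OF kl] y wz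
        by (intro sx.monomial_mult_in[of _ "arrow w y l"]) (simp_all add: AG_carrier_iff arrow_Mor Src_arrow Tgt_arrow)
      then show ?thesis using D_carrier[OF arrow_Mor[OF y wz(2) QG(1)[OF kl]]] by blast
    qed
    let ?s = "\<lambda>q y. ?t (?p (q, y))"
    have s_in: "?s q y \<in> carrier A" if "q \<in> Q" "y \<in> Y" for q y
      using t_in[of "fst q" "snd q" y] that by (simp add: case_prod_beta)
    have "(f \<otimes>\<^bsub>AG\<^esub> f') (arrow w z m) = finsum A (\<lambda>i. ?t (?p i)) (Q \<times> Y)"
      unfolding lhs
    proof (rule finsum_reindex[OF _ inj_p])
      show "?t \<in> ?p ` (Q \<times> Y) \<rightarrow> carrier A"
        using s_in by blast
    qed
    also have "\<dots> = finsum A (\<lambda>(q, y). ?s q y) (Q \<times> Y)"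
      by (rule arg_cong[where f = "\<lambda>t. finsum A t (Q \<times> Y)"]) (simp add: fun_eq_iff)
    also have "\<dots> = finsum A (\<lambda>q. finsum A (?s q) Y) Q"
      by (rule finsum_Times[symmetric]) (use finQ finite_Obj s_in in blast)+
    also have "\<dots> = finsum A (\<lambda>q. ?T q (w, z)) Q"
    proof (rule finsum_cong'[OF refl])
      show "(\<lambda>q. ?T q (w, z)) \<in> Q \<rightarrow> carrier A" using T_in C_in_A by blast
      fix q assume q: "q \<in> Q"
      obtain k l where kl: "q = (k, l)" by (cases q)
      note qG = QG[OF q[unfolded kl]]
      have "?T q (w, z) = (\<Oplus>\<^bsub>A\<^esub>y\<in>Y. \<alpha> (arrow y z k)
          (\<alpha> (ginv Gr (arrow y z k)) (?F k (y, z)) \<otimes>\<^bsub>A\<^esub> ?F' l (w, y)))"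
        unfolding kl T_eq[OF q[unfolded kl]]
        by (rule eps_monomial_mult[OF qG(1) FE(1)[OF qG(1)] E_carrier[OF FE(2)[OF qG(2)]] wz])
      also have "\<dots> = finsum A (?s q) Y"
      proof (rule finsum_cong'[OF refl])
        show "?s q \<in> Y \<rightarrow> carrier A" using s_in[OF q] by blast
      qed (use qG wz in \<open>simp add: kl regroup_apply\<close>)
      finally show "finsum A (?s q) Y = ?T q (w, z)" by simp
    qed
    also have "\<dots> = (?F \<otimes>\<^bsub>CG\<^esub> ?F') m (w, z)"
      unfolding rhs
    proof (rule conjunct2[OF finsum_additive_on[OF sz.abelian_monoid_axioms abelian_monoid_axioms,
          where H = "carrier C" and \<phi> = "\<lambda>a. a (w, z)"], symmetric])
      show "?T q \<in> carrier C" if "q \<in> Q" for q by (rule T_in[OF that])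
    qed (use finQ in \<open>simp_all add: C_in_A C_add_apply C_zero_apply\<close>)
    finally show ?thesis using m wz by (simp add: u regroup_apply)
  qed
qed

lemma regroup_one: "regroup \<one>\<^bsub>AG\<^esub> = \<one>\<^bsub>CG\<^esub>"
proof (intro ext)
  fix k u
  have CG_one: "\<one>\<^bsub>CG\<^esub> k = (if k = x then C_one else \<zero>\<^bsub>C\<^esub>)"
    using identity_of_eqI[OF is_identity_C_one]
    by (simp add: skew_one_apply Obj_isotropy[OF x_Obj] E_x)
  have AG_one: "\<one>\<^bsub>AG\<^esub> g = (if g \<in> Y then identity_of A (D g) else \<zero>\<^bsub>A\<^esub>)" for g
    by (rule skew_one_apply)
  show "regroup \<one>\<^bsub>AG\<^esub> k u = \<one>\<^bsub>CG\<^esub> k u"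
  proof (cases "k \<in> G \<and> u \<in> Y \<times> Y")
    case False
    then have "\<one>\<^bsub>CG\<^esub> k u = \<zero>\<^bsub>A\<^esub>"
      using x_loop by (auto simp: CG_one C_zero_eq C_one_def)
    then show ?thesis using regroup_outside[OF False] by simp
  next
    case True
    then obtain y z where u: "u = (y, z)" "y \<in> Y" "z \<in> Y" and k: "k \<in> G" by blast
    have "arrow y y x = y" if "y = z" "k = x"
    proof -
      have "arrow y y x \<in> Y" using arrow_Obj_iff[OF u(2,2) x_loop] by simp
      from Src_Obj[OF this] show ?thesis using Src_arrow[OF u(2,2) x_loop] by simp
    qed
    then show ?thesis
      using u k arrow_Obj_iff[OF u(2,3) k]
      by (auto simp: CG_one AG_one regroup_apply C_one_def C_zero_eq)
  qed
qed

lemma skew_ring_iso_regroup: "AG \<simeq> CG"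
proof -
  have "regroup \<in> ring_iso AG CG"
  proof (rule ring_iso_memI)
    show "regroup (f \<oplus>\<^bsub>AG\<^esub> f') = regroup f \<oplus>\<^bsub>CG\<^esub> regroup f'" for f f'
      by (intro ext) (simp add: regroup_def skew_add_apply C_add_apply)
  qed (rule regroup_in regroup_mult regroup_one bij_betw_regroup; assumption?)+
  then show ?thesis by (auto simp: is_ring_iso_def)
qed


section \<open>The generalized matrix ring\<close>

context
  fixes n :: nat and xs :: "nat \<Rightarrow> 'g"
  assumes enum: "bij_betw xs {1..n} Y" and first: "xs 1 = x"
begin

abbreviation "M \<equiv> matrix_ring A D \<alpha> h n xs"

text \<open>A coefficient of \<open>\<delta>\<^bsub>(y, z)\<^esub>\<close> lies in the ideal at the target \<open>z\<close>, whereas the entry in position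
  \<open>(i, j)\<close> lies in the ideal at \<open>xs i\<close>: rows are indexed by targets, whence the transposition.\<close>

definition to_matrix :: "('g \<times> 'g \<Rightarrow> 'a) \<Rightarrow> nat \<Rightarrow> nat \<Rightarrow> 'a" where
  "to_matrix f i j = (if i \<in> {1..n} \<and> j \<in> {1..n} then f (xs j, xs i) else \<zero>\<^bsub>A\<^esub>)"

definition of_matrix :: "(nat \<Rightarrow> nat \<Rightarrow> 'a) \<Rightarrow> 'g \<times> 'g \<Rightarrow> 'a" where
  "of_matrix m u = (if u \<in> Y \<times> Y
     then m (inv_into {1..n} xs (snd u)) (inv_into {1..n} xs (fst u)) else \<zero>\<^bsub>A\<^esub>)"

lemma xs_Obj: "i \<in> {1..n} \<Longrightarrow> xs i \<in> Y"
  using enum by (rule bij_betwE[rule_format])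

lemma Obj_pair_eq_xs:
  assumes "u \<in> Y \<times> Y"
  obtains i j where "i \<in> {1..n}" "j \<in> {1..n}" "u = (xs j, xs i)"
proof -
  have "Y = xs ` {1..n}" using enum by (simp add: bij_betw_def)
  then have "fst u \<in> xs ` {1..n}" "snd u \<in> xs ` {1..n}" using assms by auto
  then obtain i j where "i \<in> {1..n}" "j \<in> {1..n}" "snd u = xs i" "fst u = xs j" by blast
  then show thesis by (intro that[of i j]) (simp_all add: prod_eq_iff)
qed

lemma to_matrix_apply: "\<lbrakk>i \<in> {1..n}; j \<in> {1..n}\<rbrakk> \<Longrightarrow> to_matrix f i j = f (xs j, xs i)"
  unfolding to_matrix_def by (rule if_P) blast

lemma of_matrix_apply: "\<lbrakk>i \<in> {1..n}; j \<in> {1..n}\<rbrakk> \<Longrightarrow> of_matrix m (xs j, xs i) = m i j"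
  using xs_Obj[of i] xs_Obj[of j] inv_into_f_f[OF bij_betw_imp_inj_on[OF enum]]
  by (simp add: of_matrix_def)

lemma M_carrier_iff:
  "m \<in> carrier M \<longleftrightarrow> (\<forall>i\<in>{1..n}. \<forall>j\<in>{1..n}. m i j \<in> D (xs i))
     \<and> (\<forall>i j. \<not> (i \<in> {1..n} \<and> j \<in> {1..n}) \<longrightarrow> m i j = \<zero>\<^bsub>A\<^esub>)"
  by (simp add: matrix_ring_def)

lemma M_outside: "\<lbrakk>m \<in> carrier M; \<not> (i \<in> {1..n} \<and> j \<in> {1..n})\<rbrakk> \<Longrightarrow> m i j = \<zero>\<^bsub>A\<^esub>"
  unfolding M_carrier_iff by blast

lemma M_D: "\<lbrakk>m \<in> carrier M; i \<in> {1..n}; j \<in> {1..n}\<rbrakk> \<Longrightarrow> m i j \<in> D (xs i)"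
  unfolding M_carrier_iff by blast

lemma M_in_A: "m \<in> carrier M \<Longrightarrow> m i j \<in> carrier A"
  using M_D[of m i j] M_outside[of m i j] D_Obj_carrier[OF xs_Obj]
  by (cases "i \<in> {1..n} \<and> j \<in> {1..n}") auto

lemma M_add_apply: "(m \<oplus>\<^bsub>M\<^esub> m') i j = m i j \<oplus>\<^bsub>A\<^esub> m' i j"
  and M_zero_apply: "\<zero>\<^bsub>M\<^esub> i j = \<zero>\<^bsub>A\<^esub>"
  by (simp_all add: matrix_ring_def)

lemma abelian_monoid_M: "abelian_monoid M"
proof (rule abelian_monoidI)
  fix m m' assume m: "m \<in> carrier M" and m': "m' \<in> carrier M"
  show "m \<oplus>\<^bsub>M\<^esub> m' \<in> carrier M"
    unfolding M_carrier_iff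
  proof (intro conjI ballI allI impI)
    fix i j assume ij: "i \<in> {1..n}" "j \<in> {1..n}"
    show "(m \<oplus>\<^bsub>M\<^esub> m') i j \<in> D (xs i)"
      unfolding M_add_apply
      by (rule D_add[OF Obj_Mor[OF xs_Obj[OF ij(1)]] M_D[OF m ij] M_D[OF m' ij]])
  next
    fix i j assume "\<not> (i \<in> {1..n} \<and> j \<in> {1..n})"
    then show "(m \<oplus>\<^bsub>M\<^esub> m') i j = \<zero>\<^bsub>A\<^esub>"
      using M_outside[OF m] M_outside[OF m'] by (simp add: M_add_apply)
  qed
  show "m \<oplus>\<^bsub>M\<^esub> m' = m' \<oplus>\<^bsub>M\<^esub> m"
    using M_in_A[OF m] M_in_A[OF m'] by (intro ext) (simp add: M_add_apply a_comm)
  show "\<zero>\<^bsub>M\<^esub> \<oplus>\<^bsub>M\<^esub> m = m"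
    using M_in_A[OF m] by (intro ext) (simp add: M_add_apply M_zero_apply)
  fix m'' assume m'': "m'' \<in> carrier M"
  show "(m \<oplus>\<^bsub>M\<^esub> m') \<oplus>\<^bsub>M\<^esub> m'' = m \<oplus>\<^bsub>M\<^esub> (m' \<oplus>\<^bsub>M\<^esub> m'')"
    using M_in_A[OF m] M_in_A[OF m'] M_in_A[OF m'']
    by (intro ext) (simp add: M_add_apply a_assoc)
qed (use D_zero[OF Obj_Mor[OF xs_Obj]] in \<open>simp add: M_carrier_iff M_zero_apply\<close>)

lemma to_matrix_in: "f \<in> carrier C \<Longrightarrow> to_matrix f \<in> carrier M"
  using C_D xs_Obj unfolding M_carrier_iff by (simp add: to_matrix_def)

lemma of_matrix_in:
  assumes m: "m \<in> carrier M"
  shows "of_matrix m \<in> carrier C"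
  unfolding C_carrier_iff
proof (intro conjI ballI allI impI)
  fix y z assume "y \<in> Y" "z \<in> Y"
  then have "(y, z) \<in> Y \<times> Y" by blast
  then obtain i j where ij: "i \<in> {1..n}" "j \<in> {1..n}" "(y, z) = (xs j, xs i)"
    by (rule Obj_pair_eq_xs)
  show "of_matrix m (y, z) \<in> D z"
    using M_D[OF m ij(1,2)] of_matrix_apply[OF ij(1,2), of m] ij(3) by simp
qed (simp add: of_matrix_def)

lemma to_matrix_of_matrix:
  assumes m: "m \<in> carrier M"
  shows "to_matrix (of_matrix m) = m"
proof (intro ext)
  fix i j
  show "to_matrix (of_matrix m) i j = m i j"
  proof (cases "i \<in> {1..n} \<and> j \<in> {1..n}")
    case True
    then show ?thesis by (simp only: to_matrix_apply of_matrix_apply)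
  next
    case False
    then show ?thesis unfolding to_matrix_def if_not_P[OF False] by (rule M_outside[OF m, symmetric])
  qed
qed

lemma bij_betw_to_matrix: "bij_betw to_matrix (carrier C) (carrier M)"
proof (rule bij_betw_byWitness[where f' = of_matrix])
  show "\<forall>f\<in>carrier C. of_matrix (to_matrix f) = f"
  proof (intro ballI ext)
    fix f u assume f: "f \<in> carrier C"
    show "of_matrix (to_matrix f) u = f u"
    proof (cases "u \<in> Y \<times> Y")
      case True
      then obtain i j where "i \<in> {1..n}" "j \<in> {1..n}" "u = (xs j, xs i)"
        by (rule Obj_pair_eq_xs)
      then show ?thesis by (simp only: of_matrix_apply to_matrix_apply)
    next
      case False
      then show ?thesis using C_out[OF f False] by (simp add: of_matrix_def)
    qed
  qed
qed (use to_matrix_of_matrix to_matrix_in of_matrix_in in blast)+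

text \<open>The product in the matrix ring inverts \<open>\<theta>\<^bsub>ij\<^esub>\<close> as a map between sets; the inverse is the action of
  the pair \<open>(x\<^sub>j, x\<^sub>i)\<close> of the coarse groupoid, which makes the two products agree.\<close>

lemma inv_theta2:
  assumes ij: "i \<in> {1..n}" "j \<in> {1..n}" and b: "b \<in> D (xs j)"
  shows "inv_into (D (xs i)) (theta2 D \<alpha> h xs i j) b = \<theta> (xs i) (\<theta>' (xs j) b)"
proof (rule inv_into_f_eq)
  note o = xs_Obj[OF ij(1)] xs_Obj[OF ij(2)]
  have inv: "inv_into (D x) (\<theta> (xs i)) a = \<theta>' (xs i) a" if a: "a \<in> D (xs i)" for a
  proof (rule inv_into_f_eq)
    show "inj_on (\<theta> (xs i)) (D x)" 
      by (rule inj_on_inverseI[where g = "\<theta>' (xs i)"]) (rule \<theta>'_\<theta>[OF o(1)])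
  qed (rule \<theta>'_in[OF o(1) a], rule \<theta>_\<theta>'[OF o(1) a])
  have theta2: "theta2 D \<alpha> h xs i j a = \<theta> (xs j) (\<theta>' (xs i) a)" if "a \<in> D (xs i)" for a
    using inv[OF that] first by (simp add: theta2_def theta_def)
  show "inj_on (theta2 D \<alpha> h xs i j) (D (xs i))"
    by (rule inj_on_inverseI[where g = "\<lambda>b. \<theta> (xs i) (\<theta>' (xs j) b)"])
      (simp add: theta2 \<theta>'_\<theta> \<theta>_\<theta>' \<theta>'_in o)
  show "\<theta> (xs i) (\<theta>' (xs j) b) \<in> D (xs i)"
    by (rule \<theta>_in[OF o(1) \<theta>'_in[OF o(2) b]])
  then show "theta2 D \<alpha> h xs i j (\<theta> (xs i) (\<theta>' (xs j) b)) = b"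
    using b by (simp add: theta2 \<theta>'_\<theta> \<theta>_\<theta>' \<theta>'_in o)
qed

lemma to_matrix_mult:
  assumes f: "f \<in> carrier C" and f': "f' \<in> carrier C"
  shows "to_matrix (f \<otimes>\<^bsub>C\<^esub> f') = to_matrix f \<otimes>\<^bsub>M\<^esub> to_matrix f'"
proof (intro ext)
  fix i k
  have M_mult: "(m \<otimes>\<^bsub>M\<^esub> m') i k = (if i \<in> {1..n} \<and> k \<in> {1..n}
        then (\<Oplus>\<^bsub>A\<^esub>j\<in>{1..n}. m i j \<otimes>\<^bsub>A\<^esub> inv_into (D (xs i)) (theta2 D \<alpha> h xs i j) (m' j k))
        else \<zero>\<^bsub>A\<^esub>)" for m m'
    by (simp add: matrix_ring_def)
  show "to_matrix (f \<otimes>\<^bsub>C\<^esub> f') i k = (to_matrix f \<otimes>\<^bsub>M\<^esub> to_matrix f') i k"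
  proof (cases "i \<in> {1..n} \<and> k \<in> {1..n}")
    case False
    then show ?thesis unfolding M_mult to_matrix_def[of "f \<otimes>\<^bsub>C\<^esub> f'"] by (simp only: if_False)
  next
    case True
    then have ik: "i \<in> {1..n}" "k \<in> {1..n}" by blast+
    let ?t = "\<lambda>y. f (y, xs i) \<otimes>\<^bsub>A\<^esub> \<theta> (xs i) (\<theta>' y (f' (xs k, y)))"
    have t_in: "?t y \<in> carrier A" if "y \<in> Y" for y
      by (rule D_Obj_carrier[OF xs_Obj[OF ik(1)] C_mult_term(1)[OF f f' xs_Obj[OF ik(2)] that
            xs_Obj[OF ik(1)]]])
    have "to_matrix (f \<otimes>\<^bsub>C\<^esub> f') i k = finsum A ?t Y"
      unfolding to_matrix_apply[OF ik] by (rule C_mult_apply[OF f f' xs_Obj[OF ik(2)] xs_Obj[OF ik(1)]])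
    also have "\<dots> = finsum A ?t (xs ` {1..n})"
      using enum by (simp add: bij_betw_def)
    also have "\<dots> = finsum A (\<lambda>j. ?t (xs j)) {1..n}"
    proof (rule finsum_reindex)
      show "?t \<in> xs ` {1..n} \<rightarrow> carrier A" using t_in xs_Obj by blast
    qed (rule bij_betw_imp_inj_on[OF enum])
    also have "\<dots> = (\<Oplus>\<^bsub>A\<^esub>j\<in>{1..n}. to_matrix f i j
        \<otimes>\<^bsub>A\<^esub> inv_into (D (xs i)) (theta2 D \<alpha> h xs i j) (to_matrix f' j k))"
    proof (rule finsum_cong'[OF refl])
      have eq: "?t (xs j) = to_matrix f i j
          \<otimes>\<^bsub>A\<^esub> inv_into (D (xs i)) (theta2 D \<alpha> h xs i j) (to_matrix f' j k)"
        if j: "j \<in> {1..n}" for j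
        unfolding to_matrix_apply[OF ik(1) j] to_matrix_apply[OF j ik(2)]
          inv_theta2[OF ik(1) j C_D[OF f' xs_Obj[OF ik(2)] xs_Obj[OF j]]] ..
      show "?t (xs j) = to_matrix f i j
          \<otimes>\<^bsub>A\<^esub> inv_into (D (xs i)) (theta2 D \<alpha> h xs i j) (to_matrix f' j k)"
        if j: "j \<in> {1..n}" for j
        by (rule eq[OF j])
      show "(\<lambda>j. to_matrix f i j
          \<otimes>\<^bsub>A\<^esub> inv_into (D (xs i)) (theta2 D \<alpha> h xs i j) (to_matrix f' j k)) \<in> {1..n} \<rightarrow> carrier A"
      proof
        fix j assume j: "j \<in> {1..n}"
        show "to_matrix f i j
          \<otimes>\<^bsub>A\<^esub> inv_into (D (xs i)) (theta2 D \<alpha> h xs i j) (to_matrix f' j k) \<in> carrier A"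
          using t_in[OF xs_Obj[OF j]] unfolding eq[OF j] .
      qed
    qed
    also have "\<dots> = (to_matrix f \<otimes>\<^bsub>M\<^esub> to_matrix f') i k"
      unfolding M_mult if_P[OF True] ..
    finally show ?thesis .
  qed
qed

lemma gamma_dom_eq: "gamma_dom A D \<alpha> h n xs g = to_matrix ` E g"
proof
  show "to_matrix ` E g \<subseteq> gamma_dom A D \<alpha> h n xs g"
  proof
    fix m assume "m \<in> to_matrix ` E g"
    then obtain f where f: "f \<in> E g" "m = to_matrix f" by blast
    have "f (xs j, xs i) \<in> \<theta> (xs i) ` D g" if "i \<in> {1..n}" "j \<in> {1..n}" for i j
      using f(1) xs_Obj[OF that(1)] xs_Obj[OF that(2)] by (auto simp: eps_dom_def)
    then show "m \<in> gamma_dom A D \<alpha> h n xs g"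
      using to_matrix_in[OF E_carrier[OF f(1)]] by (simp add: gamma_dom_def f(2) to_matrix_apply)
  qed
  show "gamma_dom A D \<alpha> h n xs g \<subseteq> to_matrix ` E g"
  proof
    fix m assume m: "m \<in> gamma_dom A D \<alpha> h n xs g"
    then have mM: "m \<in> carrier M" by (simp add: gamma_dom_def)
    have "of_matrix m u \<in> \<theta> (snd u) ` D g" if u: "u \<in> Y \<times> Y" for u
    proof -
      obtain i j where "i \<in> {1..n}" "j \<in> {1..n}" "u = (xs j, xs i)"
        using u by (rule Obj_pair_eq_xs)
      then show ?thesis using m by (simp add: gamma_dom_def of_matrix_apply)
    qed
    then have "of_matrix m \<in> E g" using of_matrix_in[OF mM] unfolding eps_dom_def by blast
    then show "m \<in> to_matrix ` E g" using to_matrix_of_matrix[OF mM] by (metis imageI)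
  qed
qed

lemma gamma_map_to_matrix:
  "gamma_map A Gr D \<alpha> h n xs g (to_matrix f) = to_matrix (\<epsilon> g f)"
proof (intro ext)
  fix i j
  show "gamma_map A Gr D \<alpha> h n xs g (to_matrix f) i j = to_matrix (\<epsilon> g f) i j"
    using xs_Obj[of i] xs_Obj[of j]
    by (cases "i \<in> {1..n} \<and> j \<in> {1..n}") (auto simp: gamma_map_def to_matrix_def eps_map_def)
qed

lemma skew_ring_iso_matrix:
  "CG \<simeq> skew_ring M (isotropy Gr x) (gamma_dom A D \<alpha> h n xs) (gamma_map A Gr D \<alpha> h n xs)"
proof (rule skew_data.skew_ring_iso_transport[OF skew_data_eps abelian_monoid_M bij_betw_to_matrix])
  show "to_matrix \<zero>\<^bsub>C\<^esub> = \<zero>\<^bsub>M\<^esub>"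
    by (intro ext) (simp add: to_matrix_def M_zero_apply C_zero_apply)
  show "to_matrix (a \<oplus>\<^bsub>C\<^esub> b) = to_matrix a \<oplus>\<^bsub>M\<^esub> to_matrix b" for a b
    by (intro ext) (simp add: to_matrix_def M_add_apply C_add_apply)
  show "unital C (E y)" if "y \<in> Obj (isotropy Gr x)" for y
    using that is_identity_C_one by (auto simp: unital_def Obj_isotropy[OF x_Obj] E_x)
qed (rule to_matrix_mult gamma_dom_eq gamma_map_to_matrix; assumption?)+

end

end

section \<open>The two isomorphisms\<close>

theorem theorem6p4:
  fixes A :: "('a, 'm) ring_scheme" and Gr :: "'g groupoid"
    and D :: "'g \<Rightarrow> 'a set" and \<alpha> :: "'g \<Rightarrow> 'a \<Rightarrow> 'a"
    and x :: 'g and h :: "'g \<Rightarrow> 'g" and n :: nat and xs :: "nat \<Rightarrow> 'g"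
  assumes "groupoid Gr"
    and "connected_groupoid Gr"
    and "bij_betw xs {1..n} (Obj Gr)"
    and "n \<ge> 1"
    and "x = xs 1"
    and "partial_action A Gr D \<alpha>"
    and "group_type Gr D x h"
    and "is_direct_sum A (Obj Gr) D"
    and "\<forall>y\<in>Obj Gr. unital A (D y)"
  shows "skew_ring A Gr D \<alpha> \<simeq>
           skew_ring (coarse_skew_ring A Gr D \<alpha> h) (isotropy Gr x)
             (eps_dom A Gr D \<alpha> h) (eps_map A Gr D \<alpha> h)
       \<and> skew_ring (coarse_skew_ring A Gr D \<alpha> h) (isotropy Gr x)
             (eps_dom A Gr D \<alpha> h) (eps_map A Gr D \<alpha> h) \<simeq>
           skew_ring (matrix_ring A D \<alpha> h n xs) (isotropy Gr x)
             (gamma_dom A D \<alpha> h n xs) (gamma_map A Gr D \<alpha> h n xs)"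
proof -
  have "finite (Obj Gr)" using bij_betw_finite[OF assms(3)] by simp
  then interpret group_type_action A Gr D \<alpha> x h
    using assms(6,7,9) by (simp add: group_type_action_def group_type_action_axioms_def)
  show ?thesis
    using skew_ring_iso_regroup skew_ring_iso_matrix[OF assms(3) assms(5)[symmetric]] by (rule conjI)
qed

end
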